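(* Let $S$ be a finite set and let $\langle S\mid R\rangle^+$ be a right-complemented presentation of a monoid $M$ for which right-reversing is complete. Assume that $M$ is noetherian and has a finite Garside family. Then there exists an algorithm which, given two words $u,v\in S^*$, always terminates and either outputs a word on $S$ representing the right-lcm in $M$ of the elements represented by $u$ and $v$, or detects that these elements have no common right-multiple in $M$.
   Context: $S^*$ is the free monoid of words on $S$, with empty word $\varepsilon$. $M=\langle S\mid R\rangle^+$ is the quotient of $S^*$ by the smallest congruence $\equiv$ containing $R$; $X\equiv Y$ means that the words $X,Y$ represent the same element of $M$. Right-complemented presentation: $R$ contains no relation $w=\varepsilon$ with $w$ nonempty, no relation $s\ldots=s\ldots$ with $s\in S$, and at most one relation $s\ldots=t\ldots$ for each pair $s\neq t$ in $S$. Its syntactic right-complement is the partial map $\theta:S\times S\to S^*$ with $\theta(s,s)=\varepsilon$ for all $s$, and such that for $s\ne t$, $\theta(s,t)$ and $\theta(t,s)$ are defined iff there is a relation $s\ldots=t\ldots$ in $R$, in which case this relation is $s\,\theta(s,t)=t\,\theta(t,s)$. Right-reversing: let $\overline S$ be a formal copy of $S$, with elements $\overline s$ for $s\in S$. A signed word is a word on $S\cup\overline S$. For a signed word $w$, $\overline w$ is obtained by reversing the order of the letters and exchanging each $s$ with $\overline s$. Write $w\curvearrowright^1 w'$ if $w'$ is obtained from $w$ by replacing one subword $\overline s t$ (with $s,t\in S$ and $\theta(s,t)$ defined) by $\theta(s,t)\overline{\theta(t,s)}$ (if $s=t$ the subword is deleted), and $w\curvearrowright^*w'$ if $w'$ is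 reached from $w$ in finitely many (possibly zero) such steps. Completeness: right-reversing is complete for $\langle S\mid R\rangle^+$ if for all $u,v,\hat u,\hat v\in S^*$ with $u\hat v\equiv v\hat u$ there exist $u',v',w'\in S^*$ with $\overline u v\curvearrowright^* v'\overline{u'}$, $\hat u\equiv u'w'$ and $\hat v\equiv v'w'$. Noetherian: the proper factor relation on $M$ is well-founded (no infinite decreasing sequence), where $a$ is a proper factor of $b$ if $b=cad$ with $c,d\in M$ and at least one of $c,d$ non-invertible. Right-lcm: $a$ left-divides $b$ if $b=ac$ for some $c$ (then $c$ right-divides $b$ and $b$ is a right-multiple of $a$). A right-lcm of $a,b$ is a common right-multiple of $a,b$ that left-divides every common right-multiple of $a,b$; if it is written $aa'=bb'$, then $a'$ and $b'$ are denoted $a\backslash b$ and $b\backslash a$ and called right-complements. Under these hypotheses $M$ is left-cancellative without nontrivial invertible elements, so right-lcms and right-complements are unique when they exist. Garside family: in the setting of a right-complemented presentation with complete right-reversing, $G\subseteq M$ is a Garside family iff $G$ generates $M$ and is closed under right-lcm and right-complement (whenever $g,h\in G$ have a right-lcm, it and $g\backslash h$, $h\backslash g$ lie in $G$); equivalently, $G$ generates $M$ and is closed under right-lcm and under right-divisors. *)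

theory Defs
  imports "HOL-Algebra.Divisibility" "HOL-Library.Nat_Bijection"
begin

section \<open>Presented monoids\<close>

type_synonym 'a relations = "('a list \<times> 'a list) set"

inductive pres_cong :: "'a set \<Rightarrow> 'a relations \<Rightarrow> 'a list \<Rightarrow> 'a list \<Rightarrow> bool"
  for S :: "'a set" and R :: "'a relations" where
  base: "(u, v) \<in> R \<Longrightarrow> pres_cong S R u v"
| refl: "u \<in> lists S \<Longrightarrow> pres_cong S R u u"
| sym: "pres_cong S R u v \<Longrightarrow> pres_cong S R v u"
| trans: "pres_cong S R u v \<Longrightarrow> pres_cong S R v w \<Longrightarrow> pres_cong S R u w"
| append: "pres_cong S R u v \<Longrightarrow> pres_cong S R u' v' \<Longrightarrow> pres_cong S R (u @ u') (v @ v')"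

definition pres_rel :: "'a set \<Rightarrow> 'a relations \<Rightarrow> ('a list \<times> 'a list) set" where
  "pres_rel S R = {(u, v). pres_cong S R u v}"

definition word_class :: "'a set \<Rightarrow> 'a relations \<Rightarrow> 'a list \<Rightarrow> 'a list set" where
  "word_class S R w = pres_rel S R `` {w}"

definition presented_monoid :: "'a set \<Rightarrow> 'a relations \<Rightarrow> 'a list set monoid" where
  "presented_monoid S R =
     \<lparr>carrier = lists S // pres_rel S R,
      mult = (\<lambda>A B. \<Union>a\<in>A. \<Union>b\<in>B. word_class S R (a @ b)),
      one = word_class S R []\<rparr>"

lemma pres_cong_lists:
  assumes "R \<subseteq> lists S \<times> lists S" and "pres_cong S R u v"
  shows "u \<in> lists S \<and> v \<in> lists S"
  using assms(2)
proof induction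
  case (base u v)
  then show ?case using assms(1) by auto
qed auto

lemma equiv_pres_rel:
  assumes "R \<subseteq> lists S \<times> lists S"
  shows "equiv (lists S) (pres_rel S R)"
proof (rule equivI)
  show "pres_rel S R \<subseteq> lists S \<times> lists S"
    using pres_cong_lists[OF assms] by (auto simp: pres_rel_def)
  show "refl_on (lists S) (pres_rel S R)"
    by (auto simp: refl_on_def pres_rel_def intro: pres_cong.refl)
  show "sym (pres_rel S R)"
    by (auto simp: sym_def pres_rel_def intro: pres_cong.sym)
  show "trans (pres_rel S R)"
    by (auto simp: trans_def pres_rel_def intro: pres_cong.trans)
qed

lemma word_class_eq_iff:
  assumes "R \<subseteq> lists S \<times> lists S" and "u \<in> lists S" and "v \<in> lists S"
  shows "word_class S R u = word_class S R v \<longleftrightarrow> pres_cong S R u v"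
  using eq_equiv_class_iff[OF equiv_pres_rel[OF assms(1)] assms(2,3)]
  by (simp add: word_class_def pres_rel_def)

lemma word_class_mult:
  assumes R: "R \<subseteq> lists S \<times> lists S" and u: "u \<in> lists S" and v: "v \<in> lists S"
  shows "word_class S R u \<otimes>\<^bsub>presented_monoid S R\<^esub> word_class S R v = word_class S R (u @ v)"
proof -
  have eq: "word_class S R (a @ b) = word_class S R (u @ v)"
    if "a \<in> word_class S R u" and "b \<in> word_class S R v" for a b
  proof -
    have "pres_cong S R u a" and "pres_cong S R v b"
      using that by (auto simp: word_class_def pres_rel_def)
    then have c: "pres_cong S R (a @ b) (u @ v)"
      by (auto intro: pres_cong.append pres_cong.sym)
    then show ?thesis
      using word_class_eq_iff[OF R, of "a @ b" "u @ v"] pres_cong_lists[OF R c] by blast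
  qed
  have "u \<in> word_class S R u" and "v \<in> word_class S R v"
    using u v by (auto simp: word_class_def pres_rel_def intro: pres_cong.refl)
  then have "(\<Union>a\<in>word_class S R u. \<Union>b\<in>word_class S R v. word_class S R (a @ b)) =
      word_class S R (u @ v)"
    using eq by blast
  then show ?thesis
    by (simp add: presented_monoid_def)
qed

lemma monoid_presented_monoid:
  assumes R: "R \<subseteq> lists S \<times> lists S"
  shows "monoid (presented_monoid S R)"
proof -
  have carr: "carrier (presented_monoid S R) = word_class S R ` lists S"
    by (auto simp: presented_monoid_def quotient_def word_class_def)
  have one: "\<one>\<^bsub>presented_monoid S R\<^esub> = word_class S R []"
    by (simp add: presented_monoid_def)
  show ?thesis
    by (rule monoidI; unfold carr one; (elim imageE)?; simp add: word_class_mult[OF R])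
qed


section \<open>Right-complemented presentations and right-reversing\<close>

text \<open>A relation is an unordered equality of two words, so the conditions are imposed on
  the symmetric closure of \<open>R\<close>.\<close>

definition right_complemented :: "'a set \<Rightarrow> 'a relations \<Rightarrow> bool" where
  "right_complemented S R \<longleftrightarrow>
     R \<subseteq> lists S \<times> lists S \<and>
     (\<forall>w. w \<noteq> [] \<longrightarrow> (w, []) \<notin> R \<union> R\<inverse>) \<and>
     (\<forall>s u v. (s # u, s # v) \<notin> R) \<and>
     (\<forall>s t u v u' v'. s \<noteq> t \<longrightarrow>
        (s # u, t # v) \<in> R \<union> R\<inverse> \<longrightarrow> (s # u', t # v') \<in> R \<union> R\<inverse> \<longrightarrow> u = u' \<and> v = v')"

definition right_complement :: "'a relations \<Rightarrow> 'a \<Rightarrow> 'a \<Rightarrow> 'a list option" where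
  "right_complement R s t =
     (if s = t then Some []
      else if \<exists>u v. (s # u, t # v) \<in> R \<union> R\<inverse>
           then Some (THE u. \<exists>v. (s # u, t # v) \<in> R \<union> R\<inverse>)
           else None)"

datatype 'a signed = Pos 'a | Neg 'a

type_synonym 'a signed_word = "'a signed list"

fun bar_letter :: "'a signed \<Rightarrow> 'a signed" where
  "bar_letter (Pos s) = Neg s"
| "bar_letter (Neg s) = Pos s"

definition bar :: "'a signed_word \<Rightarrow> 'a signed_word" where
  "bar w = rev (map bar_letter w)"

abbreviation pos :: "'a list \<Rightarrow> 'a signed_word" where
  "pos u \<equiv> map Pos u"

inductive rev_step :: "'a relations \<Rightarrow> 'a signed_word \<Rightarrow> 'a signed_word \<Rightarrow> bool"
  for R :: "'a relations" where
  "right_complement R s t = Some a \<Longrightarrow> right_complement R t s = Some b \<Longrightarrow>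
   rev_step R (x @ [Neg s, Pos t] @ y) (x @ pos a @ bar (pos b) @ y)"

definition right_reverses :: "'a relations \<Rightarrow> 'a signed_word \<Rightarrow> 'a signed_word \<Rightarrow> bool" where
  "right_reverses R = (rev_step R)\<^sup>*\<^sup>*"

definition right_reversing_complete :: "'a set \<Rightarrow> 'a relations \<Rightarrow> bool" where
  "right_reversing_complete S R \<longleftrightarrow>
     (\<forall>u\<in>lists S. \<forall>v\<in>lists S. \<forall>uh\<in>lists S. \<forall>vh\<in>lists S.
        pres_cong S R (u @ vh) (v @ uh) \<longrightarrow>
        (\<exists>u'\<in>lists S. \<exists>v'\<in>lists S. \<exists>w'\<in>lists S.
           right_reverses R (bar (pos u) @ pos v) (pos v' @ bar (pos u')) \<and>
           pres_cong S R uh (u' @ w') \<and> pres_cong S R vh (v' @ w')))"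


section \<open>Noetherianity and Garside families\<close>

text \<open>Unlike the library's \<^const>\<open>properfactor\<close>, which concerns one-sided division, this is
  the two-sided notion.\<close>

definition proper_factor :: "('a, 'b) monoid_scheme \<Rightarrow> 'a \<Rightarrow> 'a \<Rightarrow> bool" where
  "proper_factor M a b \<longleftrightarrow>
     (\<exists>c\<in>carrier M. \<exists>d\<in>carrier M.
        b = c \<otimes>\<^bsub>M\<^esub> a \<otimes>\<^bsub>M\<^esub> d \<and> (c \<notin> Units M \<or> d \<notin> Units M))"

definition noetherian_monoid :: "('a, 'b) monoid_scheme \<Rightarrow> bool" where
  "noetherian_monoid M \<longleftrightarrow>
     wf {(a, b). a \<in> carrier M \<and> b \<in> carrier M \<and> proper_factor M a b}"

definition generates :: "('a, 'b) monoid_scheme \<Rightarrow> 'a set \<Rightarrow> bool" where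
  "generates M G \<longleftrightarrow>
     (\<forall>x\<in>carrier M. \<exists>gs\<in>lists G. x = foldr (\<otimes>\<^bsub>M\<^esub>) gs \<one>\<^bsub>M\<^esub>)"

text \<open>In a noncommutative monoid, \<^const>\<open>factor\<close> is left-divisibility and hence
  \<^const>\<open>islcm\<close> is the right-lcm.  The following describes Garside families only in monoids
  that admit a right-complemented presentation for which right-reversing is complete; there
  \<open>g'\<close> and \<open>h'\<close> below are the right-complements of \<open>g, h\<close> and of \<open>h, g\<close>.\<close>

definition garside_family :: "('a, 'b) monoid_scheme \<Rightarrow> 'a set \<Rightarrow> bool" where
  "garside_family M G \<longleftrightarrow>
     G \<subseteq> carrier M \<and> generates M G \<and>
     (\<forall>g\<in>G. \<forall>h\<in>G. \<forall>g'\<in>carrier M. \<forall>h'\<in>carrier M.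
        g \<otimes>\<^bsub>M\<^esub> g' = h \<otimes>\<^bsub>M\<^esub> h' \<longrightarrow> (g \<otimes>\<^bsub>M\<^esub> g') lcmof\<^bsub>M\<^esub> g h \<longrightarrow>
        g \<otimes>\<^bsub>M\<^esub> g' \<in> G \<and> g' \<in> G \<and> h' \<in> G)"


section \<open>Algorithms\<close>

text \<open>Kleene's partial recursive functions; \<open>computes p xs y\<close> means that \<open>p\<close> halts on the
  argument tuple \<open>xs\<close> with result \<open>y\<close>.  Functions applied to a tuple of unsuitable length may
  be undefined.\<close>

datatype recf =
    Zero
  | Succ
  | Proj nat
  | Comp recf "recf list"
  | PrimRec recf recf
  | Mu recf

inductive computes :: "recf \<Rightarrow> nat list \<Rightarrow> nat \<Rightarrow> bool" where
  zero: "computes Zero xs 0"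
| succ: "computes Succ [x] (Suc x)"
| proj: "i < length xs \<Longrightarrow> computes (Proj i) xs (xs ! i)"
| comp: "list_all2 (\<lambda>g y. computes g xs y) gs ys \<Longrightarrow> computes f ys z \<Longrightarrow>
    computes (Comp f gs) xs z"
| primrec_0: "computes f xs y \<Longrightarrow> computes (PrimRec f g) (0 # xs) y"
| primrec_Suc: "computes (PrimRec f g) (n # xs) r \<Longrightarrow> computes g (n # r # xs) y \<Longrightarrow>
    computes (PrimRec f g) (Suc n # xs) y"
| mu: "computes f (n # xs) 0 \<Longrightarrow> (\<And>m. m < n \<Longrightarrow> \<exists>y>0. computes f (m # xs) y) \<Longrightarrow>
    computes (Mu f) xs n"

inductive_cases computes_elims:
  "computes Zero xs y"
  "computes Succ xs y"
  "computes (Proj i) xs y"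
  "computes (Comp f gs) xs y"
  "computes (PrimRec f g) (0 # xs) y"
  "computes (PrimRec f g) (Suc n # xs) y"
  "computes (Mu f) xs y"

lemma computes_deterministic: "computes p xs y \<Longrightarrow> computes p xs z \<Longrightarrow> y = z"
proof (induction arbitrary: z rule: computes.induct)
  case (comp xs gs ys f y)
  from comp.prems obtain zs where
    zs: "list_all2 (\<lambda>g y. computes g xs y) gs zs" and f: "computes f zs z"
    by (auto elim: computes_elims)
  have "ys = zs"
    using comp.IH(1) zs by (auto simp: list_all2_conv_all_nth list_eq_iff_nth_eq)
  then show ?case using comp.IH(2) f by blast
next
  case (primrec_Suc f g n xs r y)
  from primrec_Suc.prems show ?case
    by (rule computes_elims) (use primrec_Suc.IH in blast)
next
  case (mu f n xs)
  from mu.prems have z0: "computes f (z # xs) 0"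
    and z: "\<And>m. m < z \<Longrightarrow> \<exists>y>0. computes f (m # xs) y"
    by (auto elim: computes_elims)
  show ?case
  proof (rule linorder_cases[of n z])
    assume "n < z"
    then show ?thesis using z mu.IH(1) by fastforce
  next
    assume "z < n"
    then show ?thesis using mu.IH(2) z0 by fastforce
  qed
qed (erule computes_elims; blast)+

definition word_code :: "('a \<Rightarrow> nat) \<Rightarrow> 'a list \<Rightarrow> nat" where
  "word_code e w = list_encode (map e w)"

fun answer_code :: "('a \<Rightarrow> nat) \<Rightarrow> 'a list option \<Rightarrow> nat" where
  "answer_code e None = 0"
| "answer_code e (Some w) = Suc (word_code e w)"

text \<open>Computability by a program that halts on every pair of words on \<open>S\<close>.  For finite \<open>S\<close>
  the numbering \<open>e\<close> of the letters is immaterial; all numberings are allowed.\<close>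

definition computable_on_words ::
    "'a set \<Rightarrow> ('a list \<Rightarrow> 'a list \<Rightarrow> 'a list option) \<Rightarrow> bool" where
  "computable_on_words S f \<longleftrightarrow>
     (\<forall>e. inj_on e S \<longrightarrow>
        (\<exists>p. \<forall>u\<in>lists S. \<forall>v\<in>lists S.
           computes p [word_code e u, word_code e v] (answer_code e (f u v))))"

end

theory Submission
  imports Defs "HOL-Library.Confluence"
begin

text \<open>Right-reversing the input directly would not do: it may go on forever when there is no
  common right-multiple, without any step that announces this. With finitely many states the same
  situation shows up as a missing table entry. Completeness attaches a reversal to each single
  common multiple, a priori a different one each time. Confluence makes all of them end in the same
  words, which turns completeness into a universal property. Closure under complements holds for
  every bound \<open>n\<close>, since in a grid of Garside elements opposite sides have the same
  number of factors. The letters need not be Garside elements themselves, and the size of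
  \<open>n\<close> serves to have them among the states. States are elements of the monoid, and the
  transition table is obtained by choice, not from the relations. Being finite, it is recursive all
  the same, and for a fixed presentation only the existence of a program is claimed.\<close>

text \<open>Right-reversing is confluent and sound, so completeness says that two elements with a
  common right-multiple admit complements with the universal property of a pushout, and such squares
  can be pasted.  Hence the complement of a product of at most \<open>n\<close> Garside elements under any element
  is again such a product.  Choosing \<open>n\<close> large enough for all letters gives a finite set of states
  closed under complements by letters, so \<open>v \<mapsto> s\v\<close> is computed, for a letter \<open>s\<close>, by a finite
  transducer; running it for the successive letters of \<open>u\<close> computes \<open>u\v\<close>, and \<open>u(u\v)\<close> is the
  right-lcm.  A transducer that gets stuck detects that there is no common right-multiple.\<close>

section \<open>Total recursive functions\<close>

text \<open>Only values on tuples of length \<open>k\<close> count, because programs such as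
  \<open>Succ\<close> need not halt on other tuples. Since \<open>F\<close> takes the whole tuple,
  it can be written as an ordinary term in \<open>xs ! i\<close>.\<close>

definition total_recursive :: "nat \<Rightarrow> (nat list \<Rightarrow> nat) \<Rightarrow> bool" where
  "total_recursive k F \<longleftrightarrow> (\<exists>p. \<forall>xs. length xs = k \<longrightarrow> computes p xs (F xs))"

lemma total_recursive_cong:
  assumes "total_recursive k F" and "\<And>xs. length xs = k \<Longrightarrow> F xs = G xs"
  shows "total_recursive k G"
  using assms unfolding total_recursive_def by metis

lemma total_recursive_proj: "i < k \<Longrightarrow> total_recursive k (\<lambda>xs. xs ! i)"
  unfolding total_recursive_def by (metis computes.proj)

lemma total_recursive_comp:
  assumes H: "total_recursive (length Fs) H"
    and Fs: "\<And>F. F \<in> set Fs \<Longrightarrow> total_recursive k F"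
  shows "total_recursive k (\<lambda>xs. H (map (\<lambda>F. F xs) Fs))"
proof -
  obtain p where p: "\<And>ys. length ys = length Fs \<Longrightarrow> computes p ys (H ys)"
    using H unfolding total_recursive_def by blast
  obtain P where P: "\<And>F xs. F \<in> set Fs \<Longrightarrow> length xs = k \<Longrightarrow> computes (P F) xs (F xs)"
    using Fs unfolding total_recursive_def by metis
  have "computes (Comp p (map P Fs)) xs (H (map (\<lambda>F. F xs) Fs))" if "length xs = k" for xs
    by (rule computes.comp[where ys = "map (\<lambda>F. F xs) Fs"])
      (simp_all add: list.rel_map list.rel_refl_strong p P that)
  then show ?thesis
    unfolding total_recursive_def by blast
qed

text \<open>Composition is phrased for a term \<open>h (F xs)\<close>, so that a compound expression
  is shown recursive by introduction rules that descend its syntax.\<close>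

lemma total_recursive_comp1:
  assumes "total_recursive 1 (\<lambda>xs. h (xs ! 0))" and "total_recursive k F"
  shows "total_recursive k (\<lambda>xs. h (F xs))"
  using total_recursive_comp[of "[F]" "\<lambda>xs. h (xs ! 0)" k] assms by simp

lemma total_recursive_comp2:
  assumes "total_recursive 2 (\<lambda>xs. h (xs ! 0) (xs ! 1))"
    and "total_recursive k F" and "total_recursive k G"
  shows "total_recursive k (\<lambda>xs. h (F xs) (G xs))"
  using total_recursive_comp[of "[F, G]" "\<lambda>xs. h (xs ! 0) (xs ! 1)" k] assms
  by (auto simp: numeral_2_eq_2)

lemma total_recursive_Suc:
  assumes "total_recursive k F"
  shows "total_recursive k (\<lambda>xs. Suc (F xs))"
proof (rule total_recursive_comp1[OF _ assms])
  show "total_recursive 1 (\<lambda>xs. Suc (xs ! 0))"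
    unfolding total_recursive_def
    by (intro exI[of _ Succ]) (auto simp: length_Suc_conv computes.succ)
qed

lemma total_recursive_const: "total_recursive k (\<lambda>xs. c)"
proof (induction c)
  case 0
  show ?case
    unfolding total_recursive_def using computes.zero by blast
qed (rule total_recursive_Suc)

lemma total_recursive_PrimRec:
  assumes "total_recursive k A"
    and "total_recursive (Suc (Suc k)) (\<lambda>ys. g (ys ! 0) (ys ! 1) (drop 2 ys))"
  shows "total_recursive (Suc k) (\<lambda>xs. rec_nat (A (tl xs)) (\<lambda>n r. g n r (tl xs)) (hd xs))"
proof -
  obtain p q where p: "\<And>xs. length xs = k \<Longrightarrow> computes p xs (A xs)"
    and q: "\<And>ys. length ys = Suc (Suc k) \<Longrightarrow> computes q ys (g (ys ! 0) (ys ! 1) (drop 2 ys))"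
    using assms unfolding total_recursive_def by blast
  have "computes (PrimRec p q) (n # xs) (rec_nat (A xs) (\<lambda>n r. g n r xs) n)"
    if xs: "length xs = k" for n xs
  proof (induction n)
    case 0
    show ?case using p[OF xs] by (simp add: computes.primrec_0)
  next
    case (Suc n)
    show ?case
      using computes.primrec_Suc[OF Suc] q[of "n # rec_nat (A xs) (\<lambda>n r. g n r xs) n # xs"] xs
      by simp
  qed
  then have "computes (PrimRec p q) xs (rec_nat (A (tl xs)) (\<lambda>n r. g n r (tl xs)) (hd xs))"
    if "length xs = Suc k" for xs
    using that by (cases xs) auto
  then show ?thesis
    unfolding total_recursive_def by blast
qed

lemma total_recursive_rec_nat:
  assumes g: "total_recursive 2 (\<lambda>xs. g (xs ! 0) (xs ! 1))" and N: "total_recursive k N"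
  shows "total_recursive k (\<lambda>xs. rec_nat c g (N xs))"
proof (rule total_recursive_comp1[OF _ N])
  have "total_recursive (Suc 0) (\<lambda>xs. rec_nat c (\<lambda>n r. g n r) (hd xs))"
    using total_recursive_PrimRec[of 0 "\<lambda>_. c" "\<lambda>n r _. g n r"] g
    by (simp add: total_recursive_const numeral_2_eq_2)
  then show "total_recursive 1 (\<lambda>xs. rec_nat c g (xs ! 0))"
    unfolding One_nat_def by (rule total_recursive_cong) (auto simp: length_Suc_conv)
qed

lemma total_recursive_funpow:
  assumes h: "total_recursive 1 (\<lambda>xs. h (xs ! 0))"
    and N: "total_recursive k N" and A: "total_recursive k A"
  shows "total_recursive k (\<lambda>xs. (h ^^ N xs) (A xs))"
proof (rule total_recursive_comp2[OF _ N A])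
  have "total_recursive (Suc 1) (\<lambda>xs. rec_nat (tl xs ! 0) (\<lambda>n r. h r) (hd xs))"
    by (rule total_recursive_PrimRec[where g = "\<lambda>n r _. h r"])
      (auto intro!: total_recursive_proj total_recursive_comp1[OF h])
  then have "total_recursive 2 (\<lambda>xs. rec_nat (tl xs ! 0) (\<lambda>n r. h r) (hd xs))"
    by (simp add: numeral_2_eq_2)
  moreover have "rec_nat a (\<lambda>n r. h r) n = (h ^^ n) a" for a n
    by (induction n) auto
  ultimately have "total_recursive 2 (\<lambda>xs. (h ^^ hd xs) (tl xs ! 0))"
    by simp
  then show "total_recursive 2 (\<lambda>xs. (h ^^ (xs ! 0)) (xs ! 1))"
    by (rule total_recursive_cong) (auto simp: numeral_2_eq_2 length_Suc_conv)
qed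

lemma total_recursive_Least:
  assumes P: "total_recursive 2 (\<lambda>xs. P (xs ! 0) (xs ! 1))"
    and ex: "\<And>x. \<exists>n. P n x = 0" and F: "total_recursive k F"
  shows "total_recursive k (\<lambda>xs. LEAST n. P n (F xs) = 0)"
proof (rule total_recursive_comp1[OF _ F])
  obtain p where p: "\<And>xs. length xs = 2 \<Longrightarrow> computes p xs (P (xs ! 0) (xs ! 1))"
    using P unfolding total_recursive_def by blast
  have "computes (Mu p) [x] (LEAST n. P n x = 0)" for x
  proof (rule computes.mu)
    show "computes p [LEAST n. P n x = 0, x] 0"
      using p[of "[LEAST n. P n x = 0, x]"] LeastI_ex[OF ex[of x]] by simp
    fix m assume "m < (LEAST n. P n x = 0)"
    then have "P m x > 0"
      using not_less_Least by blast
    then show "\<exists>y>0. computes p [m, x] y"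
      using p[of "[m, x]"] by auto
  qed
  then show "total_recursive 1 (\<lambda>xs. LEAST n. P n (xs ! 0) = 0)"
    unfolding total_recursive_def by (intro exI[of _ "Mu p"]) (auto simp: length_Suc_conv)
qed

section \<open>Arithmetic, case distinction and finite tables\<close>

lemma total_recursive_add:
  assumes "total_recursive k F" and "total_recursive k G"
  shows "total_recursive k (\<lambda>xs. F xs + G xs)"
proof -
  have "total_recursive k (\<lambda>xs. (Suc ^^ F xs) (G xs))"
    by (intro total_recursive_funpow total_recursive_Suc total_recursive_proj assms) simp
  then show ?thesis
    by (simp add: Suc_funpow)
qed

lemma total_recursive_diff:
  assumes "total_recursive k F" and "total_recursive k G"
  shows "total_recursive k (\<lambda>xs. F xs - G xs)"
proof -
  define pred where "pred = rec_nat (0::nat) (\<lambda>n r. n)"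
  have pred: "pred n = n - 1" for n
    by (cases n) (simp_all add: pred_def)
  have "total_recursive 1 (\<lambda>xs. pred (xs ! 0))"
    unfolding pred_def by (intro total_recursive_rec_nat total_recursive_proj) simp_all
  then have "total_recursive k (\<lambda>xs. (pred ^^ G xs) (F xs))"
    using assms by (rule_tac total_recursive_funpow)
  moreover have "(pred ^^ n) m = m - n" for n m
    by (induction n) (simp_all add: pred)
  ultimately show ?thesis
    by simp
qed

lemma total_recursive_if:
  assumes C: "total_recursive k C" and F: "total_recursive k F" and G: "total_recursive k G"
  shows "total_recursive k (\<lambda>xs. if C xs = 0 then F xs else G xs)"
proof -
  \<comment> \<open>Primitive recursion as a case distinction: the value of \<open>C\<close> is the
    recursion argument, and the step discards both the counter and the previous value.\<close>
  let ?h = "\<lambda>xs :: nat list. rec_nat (tl xs ! 0) (\<lambda>n r. tl xs ! 1) (hd xs)"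
  have "total_recursive (Suc (Suc 2)) (\<lambda>ys. drop 2 ys ! 1)"
    by (rule total_recursive_cong[OF total_recursive_proj[of 3]]) (simp_all add: numeral_3_eq_3)
  then have "total_recursive (Suc 2) ?h"
    by (intro total_recursive_PrimRec[where g = "\<lambda>n r ys. ys ! 1"] total_recursive_proj) simp_all
  then have "total_recursive k (\<lambda>xs. ?h (map (\<lambda>F. F xs) [C, F, G]))"
    using C F G by (intro total_recursive_comp) (auto simp: numeral_3_eq_3)
  moreover have "rec_nat a (\<lambda>n r. b) n = (if n = 0 then a else b)" for a b n :: nat
    by (cases n) simp_all
  ultimately show ?thesis
    by simp
qed

text \<open>The support is emptied one point at a time, at the cost of one equality test each. This
  is how an arbitrary transition table enters a program.\<close>

lemma total_recursive_finite_support: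
  assumes "finite {x. h x \<noteq> 0}" and F: "total_recursive k F"
  shows "total_recursive k (\<lambda>xs. h (F xs))"
  using assms(1)
proof (induction "{x. h x \<noteq> 0}" arbitrary: h rule: finite_induct)
  case empty
  then have "h x = 0" for x
    by auto
  then show ?case
    by (simp add: total_recursive_const)
next
  case (insert a A)
  have "A = {x. (h(a := 0)) x \<noteq> 0}"
    using insert.hyps by auto
  then have "total_recursive k (\<lambda>xs. (h(a := 0)) (F xs))"
    by (rule insert.hyps(3))
  \<comment> \<open>With truncated subtraction, the sum of the two differences vanishes exactly when
    \<open>F xs = a\<close>.\<close>
  then have "total_recursive k
      (\<lambda>xs. if (F xs - a) + (a - F xs) = 0 then h a else (h(a := 0)) (F xs))"
    by (intro total_recursive_if total_recursive_add total_recursive_diff F total_recursive_const)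
  moreover have "(if (x - a) + (a - x) = 0 then h a else (h(a := 0)) x) = h x" for x
    by auto
  ultimately show ?case
    by simp
qed

section \<open>The pairing function and its projections\<close>

lemma total_recursive_triangle:
  assumes "total_recursive k F"
  shows "total_recursive k (\<lambda>xs. triangle (F xs))"
proof -
  have "triangle n = rec_nat 0 (\<lambda>n r. r + Suc n) n" for n
    by (induction n) simp_all
  moreover have "total_recursive k (\<lambda>xs. rec_nat 0 (\<lambda>n r. r + Suc n) (F xs))"
    by (intro total_recursive_rec_nat total_recursive_add total_recursive_Suc
        total_recursive_proj assms) simp_all
  ultimately show ?thesis
    by simp
qed

lemma total_recursive_prod_encode:
  assumes "total_recursive k F" and "total_recursive k G"
  shows "total_recursive k (\<lambda>xs. prod_encode (F xs, G xs))"
  unfolding prod_encode_def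
  by (simp, intro total_recursive_add total_recursive_triangle assms)

lemma triangle_mono: "m \<le> n \<Longrightarrow> triangle m \<le> triangle n"
  by (induction rule: dec_induct) simp_all

text \<open>Every number on the \<open>t\<close>-th diagonal of the pairing function is less than
  \<open>triangle (Suc t)\<close>.\<close>

lemma diagonal_eq:
  "(LEAST t. Suc z - triangle (Suc t) = 0) = fst (prod_decode z) + snd (prod_decode z)"
proof -
  obtain m n where mn: "prod_decode z = (m, n)"
    by fastforce
  then have z: "z = triangle (m + n) + m"
    using prod_decode_inverse[of z] by (simp add: prod_encode_def)
  have "(LEAST t. Suc z - triangle (Suc t) = 0) = m + n"
  proof (rule Least_equality)
    fix t assume t: "Suc z - triangle (Suc t) = 0"
    show "m + n \<le> t"
    proof (rule ccontr)
      assume "\<not> m + n \<le> t"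
      then have "triangle (Suc t) \<le> triangle (m + n)"
        by (intro triangle_mono) simp
      then show False
        using t z by linarith
    qed
  qed (simp add: z)
  then show ?thesis
    using mn by simp
qed

lemma total_recursive_diagonal:
  assumes "total_recursive k F"
  shows "total_recursive k (\<lambda>xs. fst (prod_decode (F xs)) + snd (prod_decode (F xs)))"
  unfolding diagonal_eq[symmetric]
proof (rule total_recursive_Least[OF _ _ assms])
  show "total_recursive 2 (\<lambda>xs. Suc (xs ! 1) - triangle (Suc (xs ! 0)))"
    by (intro total_recursive_diff total_recursive_triangle total_recursive_Suc
        total_recursive_proj) simp_all
  \<comment> \<open>Unbounded search is total here because \<open>t = z\<close> always succeeds:
    \<open>z < triangle (Suc z)\<close>.\<close>
  show "\<exists>t. Suc z - triangle (Suc t) = 0" for z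
    by (rule exI[of _ z]) simp
qed

lemma total_recursive_fst:
  assumes "total_recursive k F"
  shows "total_recursive k (\<lambda>xs. fst (prod_decode (F xs)))"
proof -
  have "fst (prod_decode z) = z - triangle (fst (prod_decode z) + snd (prod_decode z))" for z
    using prod_decode_inverse[of z] by (simp add: prod_encode_def split_beta)
  moreover have "total_recursive k
      (\<lambda>xs. F xs - triangle (fst (prod_decode (F xs)) + snd (prod_decode (F xs))))"
    by (intro total_recursive_diff total_recursive_triangle total_recursive_diagonal assms)
  ultimately show ?thesis
    by simp
qed

lemma total_recursive_snd:
  assumes "total_recursive k F"
  shows "total_recursive k (\<lambda>xs. snd (prod_decode (F xs)))"
proof -
  have "total_recursive k
      (\<lambda>xs. (fst (prod_decode (F xs)) + snd (prod_decode (F xs))) - fst (prod_decode (F xs)))"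
    by (intro total_recursive_diff total_recursive_diagonal total_recursive_fst assms)
  then show ?thesis
    by simp
qed

section \<open>Folding and concatenating coded lists\<close>

lemma length_le_list_encode: "length xs \<le> list_encode xs"
proof (induction xs)
  case (Cons x xs)
  then show ?case
    using le_prod_encode_2[of "list_encode xs" x] by simp
qed simp

lemma total_recursive_foldl:
  assumes h: "total_recursive 2 (\<lambda>xs. h (xs ! 0) (xs ! 1))"
    and A: "total_recursive k A" and N: "total_recursive k N"
  shows "total_recursive k (\<lambda>xs. foldl h (A xs) (list_decode (N xs)))"
proof -
  \<comment> \<open>A state pairs the code of the unread list with the accumulator. A nonempty list
    has code \<open>Suc (prod_encode (x, rest))\<close>, whence the \<open>- 1\<close>. With code 0,
    the empty list, the state stays fixed, so surplus iterations do no harm and the code itself can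
    bound their number.\<close>
  define step where "step z = (if fst (prod_decode z) = 0 then z
      else prod_encode (snd (prod_decode (fst (prod_decode z) - 1)),
        h (snd (prod_decode z)) (fst (prod_decode (fst (prod_decode z) - 1)))))" for z
  have step0: "(step ^^ n) (prod_encode (0, a)) = prod_encode (0, a)" for n a
    by (induction n) (simp_all add: step_def)
  have iterate: "(step ^^ n) (prod_encode (list_encode ys, a)) = prod_encode (0, foldl h a ys)"
    if "length ys \<le> n" for n ys a
    using that
  proof (induction ys arbitrary: n a)
    case Nil
    show ?case by (simp add: step0)
  next
    case (Cons y ys)
    then obtain m where m: "n = Suc m" "length ys \<le> m"
      by (cases n) auto
    have "step (prod_encode (list_encode (y # ys), a)) = prod_encode (list_encode ys, h a y)"
      by (simp add: step_def)
    then show ?case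
      using Cons.IH[OF m(2)] m(1) by (simp del: funpow.simps(2) add: funpow_Suc_right)
  qed
  have "total_recursive k (\<lambda>xs. snd (prod_decode ((step ^^ N xs) (prod_encode (N xs, A xs)))))"
    unfolding step_def
    by (intro total_recursive_snd total_recursive_funpow total_recursive_prod_encode A N
        total_recursive_if total_recursive_fst total_recursive_diff total_recursive_proj
        total_recursive_const total_recursive_comp2[OF h]) simp_all
  moreover have "snd (prod_decode ((step ^^ n) (prod_encode (n, a)))) = foldl h a (list_decode n)"
    for n a
    using iterate[OF length_le_list_encode, of "list_decode n" a] by simp
  ultimately show ?thesis
    by simp
qed

lemma total_recursive_append:
  assumes "total_recursive k F" and "total_recursive k G"
  shows "total_recursive k (\<lambda>xs. list_encode (list_decode (F xs) @ list_decode (G xs)))"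
proof -
  \<comment> \<open>This puts \<open>x\<close> at the front of the list coded by \<open>a\<close>,
    so a fold reverses. Reversing the first list before folding it onto the second restores its
    order.\<close>
  let ?snoc = "\<lambda>a x. Suc (prod_encode (x, a))"
  have fold: "foldl ?snoc (list_encode ys) xs = list_encode (rev xs @ ys)" for xs ys
    by (induction xs arbitrary: ys) (simp_all flip: list_encode.simps(2))
  have snoc: "total_recursive 2 (\<lambda>xs. ?snoc (xs ! 0) (xs ! 1))"
    by (intro total_recursive_Suc total_recursive_prod_encode total_recursive_proj) simp_all
  have "total_recursive k (\<lambda>xs. foldl ?snoc (G xs) (list_decode (foldl ?snoc 0 (list_decode (F xs)))))"
    by (intro total_recursive_foldl snoc assms total_recursive_const)
  moreover have "foldl ?snoc g (list_decode (foldl ?snoc 0 (list_decode f)))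
      = list_encode (list_decode f @ list_decode g)" for f g
    using fold[of "[]" "list_decode f"] fold[of "list_decode g" "rev (list_decode f)"] by simp
  ultimately show ?thesis
    by simp
qed

section \<open>Finite transducers\<close>

definition transducer_step ::
    "('q \<Rightarrow> 'a \<Rightarrow> ('q \<times> 'a list) option) \<Rightarrow> ('q \<times> 'a list) option \<Rightarrow> 'a \<Rightarrow> ('q \<times> 'a list) option" where
  "transducer_step \<delta> c s =
     Option.bind c (\<lambda>(q, w). map_option (\<lambda>(q', w'). (q', w @ w')) (\<delta> q s))"

lemma transducer_step_simps [simp]:
  "transducer_step \<delta> None s = None"
  "transducer_step \<delta> (Some (q, w)) s = map_option (\<lambda>(q', w'). (q', w @ w')) (\<delta> q s)"
  by (simp_all add: transducer_step_def)

lemma foldl_transducer_step_None [simp]: "foldl (transducer_step \<delta>) None v = None"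
  by (induction v) simp_all

definition transduce ::
    "('q \<Rightarrow> 'a \<Rightarrow> ('q \<times> 'a list) option) \<Rightarrow> 'q \<Rightarrow> 'a list \<Rightarrow> ('q \<times> 'a list) option" where
  "transduce \<delta> q v = foldl (transducer_step \<delta>) (Some (q, [])) v"

text \<open>A single transition table serves all letters \<open>s\<close>: only the initial state
  \<open>\<iota> s\<close> depends on the letter. The state reached at the end of a run is
  dropped.\<close>

definition cascade_step ::
    "('q \<Rightarrow> 'a \<Rightarrow> ('q \<times> 'a list) option) \<Rightarrow> ('a \<Rightarrow> 'q) \<Rightarrow> 'a list option \<Rightarrow> 'a \<Rightarrow> 'a list option" where
  "cascade_step \<delta> \<iota> c s = Option.bind c (\<lambda>v. map_option snd (transduce \<delta> (\<iota> s) v))"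

lemma cascade_step_simps [simp]:
  "cascade_step \<delta> \<iota> None s = None"
  "cascade_step \<delta> \<iota> (Some v) s = map_option snd (transduce \<delta> (\<iota> s) v)"
  by (simp_all add: cascade_step_def)

lemma foldl_cascade_step_None [simp]: "foldl (cascade_step \<delta> \<iota>) None u = None"
  by (induction u) simp_all

definition cascade ::
    "('q \<Rightarrow> 'a \<Rightarrow> ('q \<times> 'a list) option) \<Rightarrow> ('a \<Rightarrow> 'q) \<Rightarrow> 'a list \<Rightarrow> 'a list \<Rightarrow> 'a list option" where
  "cascade \<delta> \<iota> u v = foldl (cascade_step \<delta> \<iota>) (Some v) u"

lemma foldl_simulation:
  assumes "\<And>c s. P c \<Longrightarrow> s \<in> S \<Longrightarrow> P (h c s) \<and> h' (enc c) (e s) = enc (h c s)"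
    and "P c" and "v \<in> lists S"
  shows "P (foldl h c v) \<and> foldl h' (enc c) (map e v) = enc (foldl h c v)"
  using assms(2,3)
proof (induction v arbitrary: c)
  case (Cons s v)
  then show ?case
    using assms(1)[of c s] by simp
qed simp

fun option_code :: "('b \<Rightarrow> nat) \<Rightarrow> 'b option \<Rightarrow> nat" where
  "option_code f None = 0"
| "option_code f (Some x) = Suc (f x)"

lemma list_decode_word_code [simp]: "list_decode (word_code e w) = map e w"
  by (simp add: word_code_def)

text \<open>The only data without an explicit formula are the values of \<open>\<delta>\<close> and
  \<open>\<iota>\<close> on finite sets, which are finite tables. The rest is nested folding over
  coded lists.\<close>

proposition computable_cascade:
  fixes \<delta> :: "'q \<Rightarrow> 'a \<Rightarrow> ('q \<times> 'a list) option" and \<iota> :: "'a \<Rightarrow> 'q"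
  assumes Q: "finite Q" and S: "finite S" and \<iota>: "\<And>s. s \<in> S \<Longrightarrow> \<iota> s \<in> Q"
    and \<delta>: "\<And>q s q' w. q \<in> Q \<Longrightarrow> s \<in> S \<Longrightarrow> \<delta> q s = Some (q', w) \<Longrightarrow> q' \<in> Q \<and> w \<in> lists S"
  shows "computable_on_words S (\<lambda>u v. map_option ((@) u) (cascade \<delta> \<iota> u v))"
  unfolding computable_on_words_def
proof (intro allI impI)
  fix e :: "'a \<Rightarrow> nat" assume e: "inj_on e S"
  obtain \<kappa> :: "'q \<Rightarrow> nat" where \<kappa>: "inj_on \<kappa> Q"
    using finite_imp_inj_to_nat_seg[OF Q] by blast
  define pc where "pc = (\<lambda>(q, w). prod_encode (\<kappa> q, word_code e w))"
  \<comment> \<open>The default 0 outside the coded pairs makes the support finite; on a coded pair,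
    0 means that the transition is missing.\<close>
  define T where "T z = (if z \<in> prod_encode ` (\<kappa> ` Q \<times> e ` S)
      then option_code pc
        (\<delta> (inv_into Q \<kappa> (fst (prod_decode z))) (inv_into S e (snd (prod_decode z))))
      else 0)" for z
  define J where "J n = (if n \<in> e ` S then \<kappa> (\<iota> (inv_into S e n)) else 0)" for n
  have T: "T (prod_encode (\<kappa> q, e s)) = option_code pc (\<delta> q s)" if "q \<in> Q" "s \<in> S" for q s
    using that \<kappa> e by (auto simp: T_def)
  have J: "J (e s) = \<kappa> (\<iota> s)" if "s \<in> S" for s
    using that e by (auto simp: J_def)
  have T_finite: "finite {z. T z \<noteq> 0}"
    by (rule finite_subset[of _ "prod_encode ` (\<kappa> ` Q \<times> e ` S)"]) (auto simp: T_def Q S)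
  have J_finite: "finite {n. J n \<noteq> 0}"
    by (rule finite_subset[of _ "e ` S"]) (auto simp: J_def S)

  \<comment> \<open>From here on 0 codes failure, and \<open>c - 1\<close> removes the
    \<open>Suc\<close> that marks success.\<close>
  define t where "t c x = T (prod_encode (fst (prod_decode (c - 1)), x))" for c x
  define inner where "inner c x = (if c = 0 then 0 else if t c x = 0 then 0 else
      Suc (prod_encode (fst (prod_decode (t c x - 1)),
        list_encode (list_decode (snd (prod_decode (c - 1))) @
          list_decode (snd (prod_decode (t c x - 1)))))))" for c x
  \<comment> \<open>The second component 0 is the code of the empty output word.\<close>
  define run where "run n v = foldl inner (Suc (prod_encode (n, 0))) (list_decode v)" for n v
  define outer where "outer c x = (if c = 0 then 0 else if run (J x) (c - 1) = 0 then 0 else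
      Suc (snd (prod_decode (run (J x) (c - 1) - 1))))" for c x
  define result where "result u v = foldl outer (Suc v) (list_decode u)" for u v
  define answer where "answer u v = (if result u v = 0 then 0 else
      Suc (list_encode (list_decode u @ list_decode (result u v - 1))))" for u v

  have t_rec: "total_recursive k (\<lambda>xs. t (F xs) (G xs))"
    if "total_recursive k F" "total_recursive k G" for k F G
    unfolding t_def
    by (intro total_recursive_finite_support[OF T_finite] total_recursive_prod_encode
        total_recursive_fst total_recursive_diff that total_recursive_const)
  have inner_rec: "total_recursive k (\<lambda>xs. inner (F xs) (G xs))"
    if "total_recursive k F" "total_recursive k G" for k F G
    unfolding inner_def
    by (intro total_recursive_if total_recursive_Suc total_recursive_prod_encode
        total_recursive_append total_recursive_fst total_recursive_snd
        total_recursive_diff t_rec that total_recursive_const)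
  have run_rec: "total_recursive k (\<lambda>xs. run (F xs) (G xs))"
    if "total_recursive k F" "total_recursive k G" for k F G
    unfolding run_def
    by (intro total_recursive_foldl inner_rec total_recursive_Suc total_recursive_prod_encode that
        total_recursive_const total_recursive_proj) simp_all
  have outer_rec: "total_recursive k (\<lambda>xs. outer (F xs) (G xs))"
    if "total_recursive k F" "total_recursive k G" for k F G
    unfolding outer_def
    by (intro total_recursive_if total_recursive_Suc total_recursive_snd total_recursive_diff
        run_rec total_recursive_finite_support[OF J_finite] that total_recursive_const)
  have result_rec: "total_recursive k (\<lambda>xs. result (F xs) (G xs))"
    if "total_recursive k F" "total_recursive k G" for k F G
    unfolding result_def
    by (intro total_recursive_foldl outer_rec total_recursive_Suc that total_recursive_proj)
      simp_all
  have "total_recursive 2 (\<lambda>xs. answer (xs ! 0) (xs ! 1))"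
    unfolding answer_def
    by (intro total_recursive_if total_recursive_Suc total_recursive_append total_recursive_diff
        result_rec total_recursive_const total_recursive_proj) simp_all
  then obtain p where p: "\<And>xs. length xs = 2 \<Longrightarrow> computes p xs (answer (xs ! 0) (xs ! 1))"
    unfolding total_recursive_def by blast

  \<comment> \<open>The table \<open>T\<close> is faithful on \<open>Q\<close> and \<open>S\<close>
    only, so runs must stay in \<open>Q\<close>. Outputs must be words on \<open>S\<close> because
    the next run of the cascade reads them.\<close>
  define valid where "valid c \<longleftrightarrow> (\<forall>q w. c = Some (q, w) \<longrightarrow> q \<in> Q \<and> w \<in> lists S)" for c
  have inner: "valid (transducer_step \<delta> c s) \<and>
      inner (option_code pc c) (e s) = option_code pc (transducer_step \<delta> c s)"
    if c: "valid c" and s: "s \<in> S" for c s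
  proof (cases c)
    case None
    then show ?thesis by (simp add: inner_def valid_def)
  next
    case (Some qw)
    then obtain q w where qw: "c = Some (q, w)" and "q \<in> Q" "w \<in> lists S"
      using c by (cases qw) (auto simp: valid_def)
    have "t (option_code pc c) (e s) = option_code pc (\<delta> q s)"
      using T[OF \<open>q \<in> Q\<close> s] by (simp add: t_def qw pc_def)
    then show ?thesis
      using \<delta>[OF \<open>q \<in> Q\<close> s] \<open>w \<in> lists S\<close> qw
      by (cases "\<delta> q s")
        (auto simp: inner_def valid_def pc_def word_code_def)
  qed
  have run: "valid (transduce \<delta> q v) \<and> run (\<kappa> q) (word_code e v) = option_code pc (transduce \<delta> q v)"
    if "q \<in> Q" and "v \<in> lists S" for q v
  proof -
    have "Suc (prod_encode (\<kappa> q, 0)) = option_code pc (Some (q, []))"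
      by (simp add: pc_def word_code_def)
    then show ?thesis
      unfolding transduce_def run_def
      using foldl_simulation[of valid S "transducer_step \<delta>" inner "option_code pc" e "Some (q, [])" v,
          OF inner] that by (simp add: valid_def)
  qed
  have outer: "pred_option (\<lambda>w. w \<in> lists S) (cascade_step \<delta> \<iota> c s) \<and>
      outer (answer_code e c) (e s) = answer_code e (cascade_step \<delta> \<iota> c s)"
    if c: "pred_option (\<lambda>w. w \<in> lists S) c" and s: "s \<in> S" for c s
  proof (cases c)
    case None
    then show ?thesis by (simp add: outer_def)
  next
    case (Some v)
    with c have v: "v \<in> lists S" by simp
    show ?thesis
      using run[OF \<iota>[OF s] v] J[OF s] Some
      by (cases "transduce \<delta> (\<iota> s) v")
        (auto simp: outer_def valid_def pc_def)
  qed
  have "answer (word_code e u) (word_code e v)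
      = answer_code e (map_option ((@) u) (cascade \<delta> \<iota> u v))"
    if "u \<in> lists S" and "v \<in> lists S" for u v
  proof -
    have "result (word_code e u) (word_code e v) = answer_code e (cascade \<delta> \<iota> u v)"
      unfolding result_def cascade_def
      using foldl_simulation[of "pred_option (\<lambda>w. w \<in> lists S)" S "cascade_step \<delta> \<iota>" outer
          "answer_code e" e "Some v" u, OF outer] that by simp
    then show ?thesis
      by (cases "cascade \<delta> \<iota> u v") (simp_all add: answer_def word_code_def)
  qed
  moreover have "computes p [word_code e u, word_code e v]
      (answer (word_code e u) (word_code e v))" for u v
    using p[of "[word_code e u, word_code e v]"] by simp
  ultimately show "\<exists>p. \<forall>u\<in>lists S. \<forall>v\<in>lists S. computes p [word_code e u, word_code e v]
      (answer_code e (map_option ((@) u) (cascade \<delta> \<iota> u v)))"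
    by (intro exI[of _ p] ballI) metis
qed

section \<open>Complements in monoids\<close>

text \<open>The square formed by \<open>x, y, a, b\<close> is a pushout; \<open>a\<close> and \<open>b\<close> are the complements of
  \<open>x, y\<close> and \<open>y, x\<close>.  Without cancellation this is stronger than \<open>x \<otimes> a\<close> being a
  right-lcm, and it is what makes pasting of squares possible.\<close>

definition complements :: "('a, 'b) monoid_scheme \<Rightarrow> 'a \<Rightarrow> 'a \<Rightarrow> 'a \<Rightarrow> 'a \<Rightarrow> bool" where
  "complements M x y a b \<longleftrightarrow>
     a \<in> carrier M \<and> b \<in> carrier M \<and> x \<otimes>\<^bsub>M\<^esub> a = y \<otimes>\<^bsub>M\<^esub> b \<and>
     (\<forall>a'\<in>carrier M. \<forall>b'\<in>carrier M. x \<otimes>\<^bsub>M\<^esub> a' = y \<otimes>\<^bsub>M\<^esub> b' \<longrightarrow>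
        (\<exists>c\<in>carrier M. a' = a \<otimes>\<^bsub>M\<^esub> c \<and> b' = b \<otimes>\<^bsub>M\<^esub> c))"

definition common_multiple :: "('a, 'b) monoid_scheme \<Rightarrow> 'a \<Rightarrow> 'a \<Rightarrow> bool" where
  "common_multiple M x y \<longleftrightarrow> (\<exists>a\<in>carrier M. \<exists>b\<in>carrier M. x \<otimes>\<^bsub>M\<^esub> a = y \<otimes>\<^bsub>M\<^esub> b)"

lemma garside_family_subset: "garside_family M \<G> \<Longrightarrow> \<G> \<subseteq> carrier M"
  unfolding garside_family_def by blast

lemma complements_sym: "complements M x y a b \<Longrightarrow> complements M y x b a"
  unfolding complements_def by (simp add: eq_commute) blast

lemma common_multiple_sym: "common_multiple M x y \<Longrightarrow> common_multiple M y x"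
  unfolding common_multiple_def by metis

lemma complements_closed: "complements M x y a b \<Longrightarrow> a \<in> carrier M \<and> b \<in> carrier M"
  unfolding complements_def by blast

lemma common_multiple_iff_divides:
  "common_multiple M x y \<longleftrightarrow> (\<exists>m. x divides\<^bsub>M\<^esub> m \<and> y divides\<^bsub>M\<^esub> m)"
  unfolding common_multiple_def factor_def by metis

context monoid
begin

lemma complements_one:
  assumes "x \<in> carrier G"
  shows "complements G x \<one> \<one> x"
  using assms unfolding complements_def by (simp add: bexI[of _ _])

text \<open>A solution for \<open>x\<close> and \<open>y \<otimes> z\<close> factors through the
  square of \<open>x\<close>, \<open>y\<close>, and its cofactor \<open>f\<close> is a solution for
  \<open>b\<close> and \<open>z\<close>, which factors through the second square. The universal
  property delivers \<open>z \<otimes> b' = b \<otimes> f\<close> where one would otherwise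
  cancel.\<close>

lemma complements_paste:
  assumes 1: "complements G x y a b" and 2: "complements G b z c d"
    and xyz: "x \<in> carrier G" "y \<in> carrier G" "z \<in> carrier G"
  shows "complements G x (y \<otimes> z) (a \<otimes> c) d"
proof -
  have carr: "a \<in> carrier G" "b \<in> carrier G" "c \<in> carrier G" "d \<in> carrier G"
    using complements_closed[OF 1] complements_closed[OF 2] by auto
  have "x \<otimes> (a \<otimes> c) = y \<otimes> (b \<otimes> c)"
    using 1 carr xyz unfolding complements_def by (simp flip: m_assoc)
  also have "\<dots> = y \<otimes> z \<otimes> d"
    using 2 carr xyz unfolding complements_def by (simp add: m_assoc)
  finally have eq: "x \<otimes> (a \<otimes> c) = y \<otimes> z \<otimes> d" .
  have "\<exists>g\<in>carrier G. a' = a \<otimes> c \<otimes> g \<and> b' = d \<otimes> g"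
    if ab: "a' \<in> carrier G" "b' \<in> carrier G" and "x \<otimes> a' = y \<otimes> z \<otimes> b'" for a' b'
  proof -
    have "x \<otimes> a' = y \<otimes> (z \<otimes> b')"
      using that xyz by (simp add: m_assoc)
    then obtain f where f: "f \<in> carrier G" "a' = a \<otimes> f" "z \<otimes> b' = b \<otimes> f"
      using 1 ab xyz unfolding complements_def by blast
    then have "b \<otimes> f = z \<otimes> b'"
      by simp
    then obtain g where g: "g \<in> carrier G" "f = c \<otimes> g" "b' = d \<otimes> g"
      using 2 ab f unfolding complements_def by blast
    then show ?thesis
      using f carr by (intro bexI[of _ g] conjI) (simp_all add: g m_assoc)
  qed
  then show ?thesis
    using eq carr unfolding complements_def by simp
qed

text \<open>Used contrapositively: a failure in the second square is a failure of the whole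
  rectangle.\<close>

lemma common_multiple_paste:
  assumes 1: "complements G x y a b" and m: "common_multiple G x (y \<otimes> z)"
    and xyz: "x \<in> carrier G" "y \<in> carrier G" "z \<in> carrier G"
  shows "common_multiple G b z"
proof -
  obtain c d where cd: "c \<in> carrier G" "d \<in> carrier G" "x \<otimes> c = y \<otimes> z \<otimes> d"
    using m unfolding common_multiple_def by blast
  then have "x \<otimes> c = y \<otimes> (z \<otimes> d)"
    using xyz by (simp add: m_assoc)
  then obtain f where "f \<in> carrier G" "z \<otimes> d = b \<otimes> f"
    using 1 cd xyz unfolding complements_def by blast
  then show ?thesis
    using cd unfolding common_multiple_def by metis
qed

lemma common_multiple_mult_left:
  assumes "common_multiple G x (y \<otimes> z)"
    and "y \<in> carrier G" "z \<in> carrier G"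
  shows "common_multiple G x y"
proof -
  obtain a b where "a \<in> carrier G" "b \<in> carrier G" "x \<otimes> a = y \<otimes> (z \<otimes> b)"
    using assms m_assoc unfolding common_multiple_def by auto
  then show ?thesis
    using assms(3) unfolding common_multiple_def by blast
qed

text \<open>The bridge from pushouts to right-lcms, in terms of which Garside families and the final
  answer are stated.\<close>

lemma complements_imp_lcmof:
  assumes ab: "complements G x y a b" and x: "x \<in> carrier G" and y: "y \<in> carrier G"
  shows "(x \<otimes> a) lcmof x y"
proof -
  have a: "a \<in> carrier G" and b: "b \<in> carrier G" and eq: "x \<otimes> a = y \<otimes> b"
    using ab unfolding complements_def by auto
  have "(x \<otimes> a) divides m" if "x divides m" and "y divides m" for m
  proof -
    obtain c d where "c \<in> carrier G" "d \<in> carrier G" "m = x \<otimes> c" "x \<otimes> c = y \<otimes> d"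
      using \<open>x divides m\<close> \<open>y divides m\<close> unfolding factor_def by metis
    then obtain f where "f \<in> carrier G" "m = x \<otimes> (a \<otimes> f)"
      using ab unfolding complements_def by blast
    then show ?thesis
      using a x by (auto simp: m_assoc)
  qed
  moreover have "x divides (x \<otimes> a)" and "y divides (x \<otimes> a)"
    using a b eq unfolding factor_def by blast+
  ultimately show ?thesis
    unfolding islcm_def by blast
qed

lemma garside_family_complements:
  assumes G: "garside_family G \<G>" and "g \<in> \<G>" and "h \<in> \<G>" and ab: "complements G g h a b"
  shows "a \<in> \<G> \<and> b \<in> \<G>"
proof -
  have "(g \<otimes> a) lcmof g h"
    using assms garside_family_subset[OF G] by (intro complements_imp_lcmof[OF ab]) blast+
  moreover have "a \<in> carrier G" and "b \<in> carrier G" and "g \<otimes> a = h \<otimes> b"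
    using ab unfolding complements_def by auto
  ultimately show ?thesis
    using G \<open>g \<in> \<G>\<close> \<open>h \<in> \<G>\<close> unfolding garside_family_def by blast
qed

end

text \<open>Isolates what the Garside argument takes from the presentation: common right-multiples
  give pushouts.\<close>

locale complemented_monoid = monoid G for G (structure) +
  assumes ex_complements:
    "\<lbrakk>x \<in> carrier G; y \<in> carrier G; common_multiple G x y\<rbrakk> \<Longrightarrow> \<exists>a b. complements G x y a b"
begin

abbreviation list_prod :: "'a list \<Rightarrow> 'a" where
  "list_prod gs \<equiv> foldr (\<otimes>) gs \<one>"

lemma list_prod_closed [simp]: "gs \<in> lists (carrier G) \<Longrightarrow> list_prod gs \<in> carrier G"
  by (induction gs) auto

text \<open>A row of squares with Garside sides: the complement \<open>b\<close> left over by
  \<open>h\<close> is the side that meets the remaining \<open>hs\<close>. Each square contributes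
  one factor of \<open>hs'\<close>, hence the equal lengths.\<close>

lemma garside_complements_list:
  assumes G: "garside_family G \<G>" and g: "g \<in> \<G>" and hs: "hs \<in> lists \<G>"
    and m: "common_multiple G g (list_prod hs)"
  shows "\<exists>g'\<in>\<G>. \<exists>hs'\<in>lists \<G>. length hs' = length hs \<and>
    complements G g (list_prod hs) (list_prod hs') g'"
  using g hs m
proof (induction hs arbitrary: g)
  case Nil
  then have "g \<in> carrier G"
    using garside_family_subset[OF G] by blast
  then show ?case
    using complements_one[of g] Nil by auto
next
  case (Cons h hs)
  note sub = garside_family_subset[OF G]
  have carr: "g \<in> carrier G" "h \<in> carrier G" "list_prod hs \<in> carrier G"
    using Cons.prems sub by auto
  have m: "common_multiple G g (h \<otimes> list_prod hs)"
    using Cons.prems(3) by simp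
  obtain a b where ab: "complements G g h a b"
    using ex_complements[OF _ _ common_multiple_mult_left[OF m]] carr by blast
  have "h \<in> \<G>" and "hs \<in> lists \<G>"
    using Cons.prems by auto
  then have *: "a \<in> \<G>" "b \<in> \<G>"
    using garside_family_complements[OF G _ _ ab] Cons.prems(1) carr by auto
  have "common_multiple G b (list_prod hs)"
    using common_multiple_paste[OF ab m] carr by simp
  then obtain g' hs' where "g' \<in> \<G>" "hs' \<in> lists \<G>" "length hs' = length hs"
    "complements G b (list_prod hs) (list_prod hs') g'"
    using Cons.IH[OF *(2) \<open>hs \<in> lists \<G>\<close>] by auto
  then show ?case
    using complements_paste[OF ab, of "list_prod hs" "list_prod hs'" g'] * carr
    by (intro bexI[of _ g'] bexI[of _ "a # hs'"]) auto
qed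

text \<open>Rows are stacked into a grid. Pasting extends the second argument only, so the squares
  are transposed before and after.\<close>

lemma garside_complements_lists:
  assumes G: "garside_family G \<G>" and gs: "gs \<in> lists \<G>" and hs: "hs \<in> lists \<G>"
    and m: "common_multiple G (list_prod gs) (list_prod hs)"
  shows "\<exists>gs'\<in>lists \<G>. \<exists>hs'\<in>lists \<G>. length gs' = length gs \<and> length hs' = length hs \<and>
    complements G (list_prod gs) (list_prod hs) (list_prod hs') (list_prod gs')"
  using gs hs m
proof (induction gs arbitrary: hs rule: list.induct)
  case Nil
  then have "list_prod hs \<in> carrier G"
    using lists_mono[OF garside_family_subset[OF G]] by (intro list_prod_closed) blast
  then show ?case
    using complements_sym[OF complements_one[of "list_prod hs"]] Nil by auto
next
  case (Cons g gs)
  note sub = garside_family_subset[OF G]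
  have "g \<in> \<G>" and "gs \<in> lists \<G>" and "hs \<in> lists \<G>"
    using Cons.prems by auto
  then have carr: "g \<in> carrier G" "list_prod hs \<in> carrier G" "list_prod gs \<in> carrier G"
    using lists_mono[OF sub] sub by (blast intro: list_prod_closed)+
  have m: "common_multiple G (list_prod hs) (g \<otimes> list_prod gs)"
    using common_multiple_sym[OF Cons.prems(3)] by simp
  have "common_multiple G g (list_prod hs)"
    using common_multiple_sym[OF common_multiple_mult_left[OF m]] carr by blast
  then obtain g' hs' where 1: "g' \<in> \<G>" "hs' \<in> lists \<G>" "length hs' = length hs"
    "complements G g (list_prod hs) (list_prod hs') g'"
    using garside_complements_list[OF G \<open>g \<in> \<G>\<close> \<open>hs \<in> lists \<G>\<close>] by blast
  note 2 = complements_sym[OF 1(4)]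
  have "common_multiple G (list_prod gs) (list_prod hs')"
    using common_multiple_sym[OF common_multiple_paste[OF 2 m]] carr by blast
  then obtain gs' hs'' where 3: "gs' \<in> lists \<G>" "hs'' \<in> lists \<G>" "length gs' = length gs"
    "length hs'' = length hs'"
    "complements G (list_prod gs) (list_prod hs') (list_prod hs'') (list_prod gs')"
    using Cons.IH[OF \<open>gs \<in> lists \<G>\<close> 1(2)] by blast
  have "complements G (list_prod hs) (g \<otimes> list_prod gs) (g' \<otimes> list_prod gs') (list_prod hs'')"
    using complements_paste[OF 2 complements_sym[OF 3(5)]] carr by simp
  then have "complements G (list_prod (g # gs)) (list_prod hs) (list_prod hs'') (list_prod (g' # gs'))"
    using complements_sym[of G "list_prod hs" "g \<otimes> list_prod gs"] by simp
  then show ?case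
    using 1 3 by (intro bexI[of _ "g' # gs'"] bexI[of _ hs'']) auto
qed

text \<open>Complements of products of at most \<open>n\<close> Garside elements are again such products.\<close>

lemma garside_finite_complement_closed:
  assumes G: "garside_family G \<G>" and fin: "finite \<G>" and X: "finite X" "X \<subseteq> carrier G"
  obtains Q where "finite Q" "X \<subseteq> Q" "Q \<subseteq> carrier G"
    "\<And>q x. q \<in> Q \<Longrightarrow> x \<in> X \<Longrightarrow> common_multiple G q x \<Longrightarrow>
       \<exists>a. \<exists>q'\<in>Q. complements G q x a q'"
proof -
  note sub = garside_family_subset[OF G]
  have gen: "generates G \<G>"
    using G unfolding garside_family_def by blast
  have "\<forall>x\<in>X. \<exists>gs\<in>lists \<G>. list_prod gs = x"
    using gen X unfolding generates_def by (metis subsetD)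
  then obtain d where d: "\<And>x. x \<in> X \<Longrightarrow> d x \<in> lists \<G>" "\<And>x. x \<in> X \<Longrightarrow> list_prod (d x) = x"
    by metis
  \<comment> \<open>Inserting 0 keeps the maximum meaningful for empty \<open>X\<close>.\<close>
  define n where "n = Max (insert 0 (length ` d ` X))"
  define Q where "Q = list_prod ` {gs. set gs \<subseteq> \<G> \<and> length gs \<le> n}"
  have len: "length (d x) \<le> n" if "x \<in> X" for x
    unfolding n_def using X(1) that by (intro Max_ge) auto
  show thesis
  proof
    show "finite Q"
      unfolding Q_def using finite_lists_length_le[OF fin] by blast
    show "X \<subseteq> Q"
    proof
      fix x assume x: "x \<in> X"
      show "x \<in> Q"
        unfolding Q_def
        by (rule image_eqI[of _ _ "d x"]) (use d[OF x] len[OF x] in \<open>auto simp: lists_eq_set\<close>)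
    qed
    show "Q \<subseteq> carrier G"
      unfolding Q_def using sub by (auto intro!: list_prod_closed)
    show "\<exists>a. \<exists>q'\<in>Q. complements G q x a q'"
      if q: "q \<in> Q" and x: "x \<in> X" and m: "common_multiple G q x" for q x
    proof -
      obtain gs where gs: "gs \<in> lists \<G>" "length gs \<le> n" "q = list_prod gs"
        using q unfolding Q_def by (auto simp: lists_eq_set)
      obtain gs' hs' where "gs' \<in> lists \<G>" "length gs' = length gs"
          "complements G (list_prod gs) (list_prod (d x)) (list_prod hs') (list_prod gs')"
        using garside_complements_lists[OF G gs(1), of "d x"] d[OF x] m gs by auto
      \<comment> \<open>The new state has as many factors as the old one, so the bound
        \<open>n\<close> persists.\<close>
      moreover from this have "list_prod gs' \<in> Q"
        unfolding Q_def using gs by (intro imageI) (auto simp: lists_eq_set)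
      ultimately show ?thesis
        using gs d[OF x] by auto
    qed
  qed
qed

end

section \<open>Right-reversing\<close>

lemma bar_pos: "bar (pos u) = map Neg (rev u)"
  by (simp add: bar_def rev_map)

lemma Neg_Pos_notin_pos_neg: "pos v @ map Neg r \<noteq> x @ [Neg s, Pos t] @ y"
proof (induction v arbitrary: x)
  case Nil
  have "Pos t \<notin> set (map Neg r)"
    by auto
  then show ?case
    by (metis Nil_is_append_conv append_Nil append_Cons in_set_conv_decomp list.map(1) append.assoc)
next
  case (Cons a v)
  then show ?case
    by (cases x) auto
qed

lemma pos_neg_eq_iff: "pos v @ map Neg r = pos v' @ map Neg r' \<longleftrightarrow> v = v' \<and> r = r'"
proof (induction v arbitrary: v')
  case Nil
  show ?case
    by (cases v'; cases r) (auto simp: inj_map_eq_map inj_def)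
next
  case (Cons a v)
  show ?case
  proof (cases v')
    case Nil
    then show ?thesis by (cases r') auto
  next
    case (Cons b v'')
    then show ?thesis using Cons.IH[of v''] by simp
  qed
qed

lemma not_rev_step_pos_neg: "\<not> rev_step R (pos v @ bar (pos u)) w"
proof
  assume "rev_step R (pos v @ bar (pos u)) w"
  then show False
  proof cases
    case (1 s t a b x y)
    then show False
      using Neg_Pos_notin_pos_neg[of v "rev u" x s t y] by (simp add: bar_pos)
  qed
qed

text \<open>A redex is a negative letter followed by a positive one, so two redexes cannot share
  just one letter. If they coincide, the results agree because the right-complement is a function;
  if they are disjoint, the two steps commute.\<close>

lemma confluentp_rev_step: "confluentp (rev_step R)"
proof (intro strong_confluentp_imp_confluentp strong_confluentpI)
  have ordered: "\<exists>d. (rev_step R)\<^sup>=\<^sup>= b d \<and> (rev_step R)\<^sup>=\<^sup>= c d"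
    if b: "b = x @ p @ y" "right_complement R s t = Some p1" "right_complement R t s = Some p2"
        "p = pos p1 @ bar (pos p2)"
      and c: "c = x' @ p' @ y'" "right_complement R s' t' = Some p1'"
        "right_complement R t' s' = Some p2'" "p' = pos p1' @ bar (pos p2')"
      and eq: "x @ [Neg s, Pos t] @ y = x' @ [Neg s', Pos t'] @ y'"
      and le: "length x \<le> length x'"
    for b c x y x' y' s t s' t' p1 p2 p1' p2' p p'
  proof -
    obtain z where z: "x' = x @ z" "[Neg s, Pos t] @ y = z @ [Neg s', Pos t'] @ y'"
      using eq le by (auto simp: append_eq_append_conv_if) (metis append_take_drop_id)
    \<comment> \<open>A one-letter \<open>z\<close> would make the second redex begin with
      \<open>Pos t\<close>.\<close>
    consider "z = []" | z' where "z = [Neg s, Pos t] @ z'" "y = z' @ [Neg s', Pos t'] @ y'"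
      using z(2) by (cases z; cases "tl z") auto
    then show ?thesis
    proof cases
      case 1
      then have "b = c"
        using z b c by auto
      then show ?thesis by blast
    next
      case (2 z')
      have "rev_step R b ((x @ p @ z') @ p' @ y')"
        using rev_step.intros[OF c(2,3), of "x @ p @ z'" y'] b c 2 by simp
      moreover have "rev_step R c (x @ p @ (z' @ p' @ y'))"
        using rev_step.intros[OF b(2,3), of x "z' @ p' @ y'"] b c 2 z by simp
      ultimately show ?thesis by auto
    qed
  qed
  fix a b c assume "rev_step R a b" and "rev_step R a c"
  then obtain x y s t p1 p2 x' y' s' t' p1' p2' where
    b: "b = x @ (pos p1 @ bar (pos p2)) @ y" "right_complement R s t = Some p1"
      "right_complement R t s = Some p2" and
    c: "c = x' @ (pos p1' @ bar (pos p2')) @ y'" "right_complement R s' t' = Some p1'"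
      "right_complement R t' s' = Some p2'" and
    a: "x @ [Neg s, Pos t] @ y = x' @ [Neg s', Pos t'] @ y'"
    by (auto elim!: rev_step.cases)
  have "\<exists>d. (rev_step R)\<^sup>=\<^sup>= b d \<and> (rev_step R)\<^sup>=\<^sup>= c d"
  proof (cases "length x \<le> length x'")
    case True
    then show ?thesis
      using ordered[OF b HOL.refl c HOL.refl a] by simp
  next
    case False
    then show ?thesis
      using ordered[OF c HOL.refl b HOL.refl a[symmetric]] by auto
  qed
  then show "\<exists>d. (rev_step R)\<^sup>*\<^sup>* b d \<and> (rev_step R)\<^sup>=\<^sup>= c d"
    by blast
qed

text \<open>Both results have a common reduct by confluence, and both are irreducible.\<close>

lemma right_reverses_unique:
  assumes "right_reverses R w (pos v @ bar (pos u))" and "right_reverses R w (pos v' @ bar (pos u'))"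
  shows "v = v' \<and> u = u'"
proof -
  obtain z where "(rev_step R)\<^sup>*\<^sup>* (pos v @ bar (pos u)) z" "(rev_step R)\<^sup>*\<^sup>* (pos v' @ bar (pos u')) z"
    using confluentpD[OF confluentp_rev_step] assms unfolding right_reverses_def by blast
  then have "pos v @ bar (pos u) = pos v' @ bar (pos u')"
    using not_rev_step_pos_neg by (metis converse_rtranclpE)
  then show ?thesis
    by (simp add: bar_pos pos_neg_eq_iff)
qed

section \<open>Soundness of reversing for the congruence\<close>

lemma right_complement_cong:
  assumes rc: "right_complemented S R" and "s \<in> S" and "t \<in> S"
    and a: "right_complement R s t = Some a" and b: "right_complement R t s = Some b"
  shows "pres_cong S R (s # a) (t # b)"
proof (cases "s = t")
  case True
  then show ?thesis
    using assms by (auto simp: right_complement_def intro: pres_cong.refl)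
next
  case False
  then obtain u v where uv: "(s # u, t # v) \<in> R \<union> R\<inverse>"
    using a by (auto simp: right_complement_def split: if_splits)
  then have vu: "(t # v, s # u) \<in> R \<union> R\<inverse>"
    by auto
  \<comment> \<open>The two complements are given by separate definite descriptions; uniqueness
    shows that both refer to the same relation.\<close>
  have unique: "u' = u \<and> v' = v" if "(s # u', t # v') \<in> R \<union> R\<inverse>" for u' v'
    using rc False uv that unfolding right_complemented_def by blast
  have "(THE u. \<exists>v. (s # u, t # v) \<in> R \<union> R\<inverse>) = u"
    using uv unique by (intro the_equality) blast+
  moreover have "(THE v. \<exists>u. (t # v, s # u) \<in> R \<union> R\<inverse>) = v"
    using vu unique by (intro the_equality) blast+
  moreover have "\<exists>u v. (s # u, t # v) \<in> R \<union> R\<inverse>" "\<exists>v u. (t # v, s # u) \<in> R \<union> R\<inverse>"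
    using uv vu by blast+
  ultimately have "a = u" "b = v"
    using a b False unfolding right_complement_def by (simp_all split: if_splits)
  then show ?thesis
    using uv by (auto intro: pres_cong.base pres_cong.sym)
qed

text \<open>Formally \<open>a \<equiv> w b\<close>, where a leading negative letter is moved to the other side since it
  cannot be inverted.\<close>

primrec signed_rel :: "'a set \<Rightarrow> 'a relations \<Rightarrow> 'a signed_word \<Rightarrow> 'a list \<Rightarrow> 'a list \<Rightarrow> bool" where
  "signed_rel S R [] a b \<longleftrightarrow> pres_cong S R a b"
| "signed_rel S R (x # w) a b \<longleftrightarrow>
     (case x of
        Pos s \<Rightarrow> \<exists>c. pres_cong S R a (s # c) \<and> signed_rel S R w c b
      | Neg s \<Rightarrow> signed_rel S R w (s # a) b)"

context
  fixes S :: "'a set" and R :: "'a relations"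
  assumes rc: "right_complemented S R"
begin

lemma relations_subset: "R \<subseteq> lists S \<times> lists S"
  using rc unfolding right_complemented_def by blast

lemma pres_cong_in_lists: "pres_cong S R a b \<Longrightarrow> a \<in> lists S \<and> b \<in> lists S"
  by (rule pres_cong_lists[OF relations_subset])

lemma pres_cong_append_left: "w \<in> lists S \<Longrightarrow> pres_cong S R a b \<Longrightarrow> pres_cong S R (w @ a) (w @ b)"
  by (intro pres_cong.append pres_cong.refl)

lemma pres_cong_append_right: "w \<in> lists S \<Longrightarrow> pres_cong S R a b \<Longrightarrow> pres_cong S R (a @ w) (b @ w)"
  by (intro pres_cong.append pres_cong.refl)

lemma pres_cong_Cons: "s \<in> S \<Longrightarrow> pres_cong S R a b \<Longrightarrow> pres_cong S R (s # a) (s # b)"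
  using pres_cong_append_left[of "[s]"] by simp

abbreviation signed_words :: "'a signed_word set" where
  "signed_words \<equiv> lists (Pos ` S \<union> Neg ` S)"

lemma pos_in_signed_words: "pos a \<in> signed_words \<longleftrightarrow> a \<in> lists S"
  by (induction a) auto

lemma bar_pos_in_signed_words: "bar (pos a) \<in> signed_words \<longleftrightarrow> a \<in> lists S"
  unfolding bar_pos by (auto simp: lists_eq_set)

lemma signed_rel_in_lists: "signed_rel S R w a b \<Longrightarrow> a \<in> lists S"
proof (induction w arbitrary: a)
  case Nil
  then show ?case
    using pres_cong_in_lists by simp
next
  case (Cons x w)
  then show ?case
    using pres_cong_in_lists by (cases x) fastforce+
qed

text \<open>Allows a reversing step to be studied at the left end of the word.\<close>

lemma signed_rel_append_mono:
  assumes "\<And>a. signed_rel S R w a b \<Longrightarrow> signed_rel S R w' a b" and "signed_rel S R (x @ w) a b"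
  shows "signed_rel S R (x @ w') a b"
  using assms(2)
proof (induction x arbitrary: a)
  case (Cons y x)
  then show ?case
    by (cases y) auto
qed (use assms(1) in simp)

lemma signed_rel_pos_appendD:
  "v \<in> lists S \<Longrightarrow> signed_rel S R (pos v @ w) a b \<Longrightarrow>
    \<exists>c. pres_cong S R a (v @ c) \<and> signed_rel S R w c b"
proof (induction v arbitrary: a rule: list.induct)
  case Nil
  then have "signed_rel S R w a b" by simp
  with pres_cong.refl[OF signed_rel_in_lists[OF this]] show ?case
    by (intro exI[of _ a]) simp
next
  case (Cons s v)
  then obtain c where c: "pres_cong S R a (s # c)" "signed_rel S R (pos v @ w) c b" and s: "s \<in> S"
    by auto
  then obtain d where d: "pres_cong S R c (v @ d)" "signed_rel S R w d b"
    using Cons by auto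
  show ?case
    using pres_cong.trans[OF c(1) pres_cong_Cons[OF s d(1)]] d(2) by auto
qed

lemma signed_rel_pos_appendI:
  "v @ c \<in> lists S \<Longrightarrow> signed_rel S R w c b \<Longrightarrow> signed_rel S R (pos v @ w) (v @ c) b"
proof (induction v rule: list.induct)
  case (Cons s v)
  then have "signed_rel S R (pos v @ w) (v @ c) b" and "s # v @ c \<in> lists S"
    by auto
  with pres_cong.refl[OF this(2)] show ?case by auto
qed simp

lemma signed_rel_bar_append: "signed_rel S R (bar (pos u) @ w) a b \<longleftrightarrow> signed_rel S R w (u @ a) b"
  unfolding bar_pos by (induction u arbitrary: w) simp_all

text \<open>The implication runs from the result back to the original word: with complements
  \<open>p\<close>, \<open>q\<close> of the letters \<open>s\<close>, \<open>t\<close>, from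
  \<open>a \<equiv> p c\<close> follows \<open>s a \<equiv> s p c \<equiv> t q c\<close>. The
  opposite direction would make every common multiple of \<open>s\<close> and \<open>t\<close>
  factor through \<open>s p\<close>, which is a matter of completeness.\<close>

lemma rev_step_sound:
  assumes "rev_step R w w'" and w: "w \<in> signed_words"
  shows "w' \<in> signed_words \<and> (\<forall>a b. signed_rel S R w' a b \<longrightarrow> signed_rel S R w a b)"
  using assms(1)
proof cases
  case (1 s t p q x y)
  then have "s \<in> S" and "t \<in> S" and xy: "x \<in> signed_words" "y \<in> signed_words"
    using w by auto
  then have pq: "pres_cong S R (s # p) (t # q)"
    using right_complement_cong[OF rc] 1 by blast
  then have p: "p \<in> lists S" and q: "q \<in> lists S"
    using pres_cong_in_lists by fastforce+
  have "signed_rel S R ([Neg s, Pos t] @ y) a b"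
    if ab: "signed_rel S R (pos p @ bar (pos q) @ y) a b" for a b
  proof -
    obtain c where c: "pres_cong S R a (p @ c)" "signed_rel S R y (q @ c) b"
      using signed_rel_pos_appendD[OF p ab] by (auto simp: signed_rel_bar_append)
    have "c \<in> lists S"
      using pres_cong_in_lists[OF c(1)] by simp
    then have "pres_cong S R (s # p @ c) (t # q @ c)"
      using pres_cong_append_right[OF _ pq] by simp
    then have "pres_cong S R (s # a) (t # q @ c)"
      using pres_cong_Cons[OF \<open>s \<in> S\<close> c(1)] by (rule pres_cong.trans[rotated])
    then show ?thesis
      using c(2) by auto
  qed
  then have "\<forall>a b. signed_rel S R w' a b \<longrightarrow> signed_rel S R w a b"
    unfolding 1 using signed_rel_append_mono by blast
  moreover have "w' \<in> signed_words"
    unfolding 1 using xy p q pos_in_signed_words bar_pos_in_signed_words by simp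
  ultimately show ?thesis by blast
qed

text \<open>The final word relates \<open>v'\<close> to \<open>u'\<close> by construction. Carried
  back to \<open>bar (pos u) @ pos v\<close>, the same relation is the desired congruence.\<close>

lemma right_reverses_sound:
  assumes u: "u \<in> lists S" and v: "v \<in> lists S" and u': "u' \<in> lists S" and v': "v' \<in> lists S"
    and rev: "right_reverses R (bar (pos u) @ pos v) (pos v' @ bar (pos u'))"
  shows "pres_cong S R (u @ v') (v @ u')"
proof -
  have "w' \<in> signed_words \<and> (\<forall>a b. signed_rel S R w' a b \<longrightarrow> signed_rel S R w a b)"
    if "(rev_step R)\<^sup>*\<^sup>* w w'" and "w \<in> signed_words" for w w'
    using that
  proof (induction rule: rtranclp_induct)
    case (step y z)
    then show ?case
      using rev_step_sound[OF step.hyps(2)] by blast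
  qed blast
  moreover have "bar (pos u) @ pos v \<in> signed_words"
    using u v pos_in_signed_words bar_pos_in_signed_words by simp
  moreover have "signed_rel S R (pos v' @ bar (pos u')) v' u'"
    using signed_rel_pos_appendI[of v' "[]" "bar (pos u')" u'] signed_rel_bar_append[of u' "[]"]
      u' v' by (simp add: pres_cong.refl)
  ultimately have "signed_rel S R (bar (pos u) @ pos v) v' u'"
    using rev unfolding right_reverses_def by blast
  then have "signed_rel S R (pos v @ []) (u @ v') u'"
    by (simp add: signed_rel_bar_append)
  then obtain c where "pres_cong S R (u @ v') (v @ c)" "pres_cong S R c u'"
    using signed_rel_pos_appendD[OF v] by fastforce
  then show ?thesis
    using pres_cong_append_left[OF v] by (blast intro: pres_cong.trans)
qed

section \<open>Pushouts in the presented monoid\<close>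

lemma carrier_presented_monoid: "carrier (presented_monoid S R) = word_class S R ` lists S"
  by (auto simp: presented_monoid_def quotient_def word_class_def)

lemma ex_complements_presented_monoid:
  assumes complete: "right_reversing_complete S R"
    and u: "u \<in> lists S" and v: "v \<in> lists S"
    and m: "common_multiple (presented_monoid S R) (word_class S R u) (word_class S R v)"
  shows "\<exists>a b. complements (presented_monoid S R) (word_class S R u) (word_class S R v) a b"
proof -
  let ?M = "presented_monoid S R" and ?c = "word_class S R"
  note mult = word_class_mult[OF relations_subset]
  have eq: "?c u \<otimes>\<^bsub>?M\<^esub> ?c vh = ?c v \<otimes>\<^bsub>?M\<^esub> ?c uh \<longleftrightarrow> pres_cong S R (u @ vh) (v @ uh)"
    if "uh \<in> lists S" "vh \<in> lists S" for uh vh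
    using that u v by (simp add: mult word_class_eq_iff[OF relations_subset])
  have reversing: "\<exists>u'\<in>lists S. \<exists>v'\<in>lists S. \<exists>w'\<in>lists S.
      right_reverses R (bar (pos u) @ pos v) (pos v' @ bar (pos u')) \<and>
      ?c uh = ?c u' \<otimes>\<^bsub>?M\<^esub> ?c w' \<and> ?c vh = ?c v' \<otimes>\<^bsub>?M\<^esub> ?c w'"
    if h: "uh \<in> lists S" "vh \<in> lists S" "?c u \<otimes>\<^bsub>?M\<^esub> ?c vh = ?c v \<otimes>\<^bsub>?M\<^esub> ?c uh" for uh vh
  proof -
    have "pres_cong S R (u @ vh) (v @ uh)"
      using eq[OF h(1,2)] h(3) by blast
    note complete[unfolded right_reversing_complete_def, rule_format, OF u v h(1,2) this]
    then obtain u' v' w' where *: "u' \<in> lists S" "v' \<in> lists S" "w' \<in> lists S"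
      "right_reverses R (bar (pos u) @ pos v) (pos v' @ bar (pos u'))"
      "pres_cong S R uh (u' @ w')" "pres_cong S R vh (v' @ w')"
      by blast
    then have "?c uh = ?c u' \<otimes>\<^bsub>?M\<^esub> ?c w'" "?c vh = ?c v' \<otimes>\<^bsub>?M\<^esub> ?c w'"
      using h by (simp_all add: mult word_class_eq_iff[OF relations_subset])
    with * show ?thesis by blast
  qed
  \<comment> \<open>The given common multiple guarantees that some reversal ends; its final words
    are fixed once and for all.\<close>
  obtain uh vh where h: "uh \<in> lists S" "vh \<in> lists S" "?c u \<otimes>\<^bsub>?M\<^esub> ?c vh = ?c v \<otimes>\<^bsub>?M\<^esub> ?c uh"
    using m unfolding common_multiple_def carrier_presented_monoid by blast
  obtain u' v' where u': "u' \<in> lists S" and v': "v' \<in> lists S"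
    and rev: "right_reverses R (bar (pos u) @ pos v) (pos v' @ bar (pos u'))"
    using reversing[OF h] by blast
  have "?c u \<otimes>\<^bsub>?M\<^esub> ?c v' = ?c v \<otimes>\<^bsub>?M\<^esub> ?c u'"
    using right_reverses_sound[OF u v u' v' rev] eq[OF u' v'] by blast
  moreover have "\<exists>c\<in>carrier ?M. ?c vh = ?c v' \<otimes>\<^bsub>?M\<^esub> c \<and> ?c uh = ?c u' \<otimes>\<^bsub>?M\<^esub> c"
    if h: "uh \<in> lists S" "vh \<in> lists S" "?c u \<otimes>\<^bsub>?M\<^esub> ?c vh = ?c v \<otimes>\<^bsub>?M\<^esub> ?c uh" for uh vh
  proof -
    obtain u'' v'' w' where "w' \<in> lists S"
      "right_reverses R (bar (pos u) @ pos v) (pos v'' @ bar (pos u''))"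
      and *: "?c uh = ?c u'' \<otimes>\<^bsub>?M\<^esub> ?c w'" "?c vh = ?c v'' \<otimes>\<^bsub>?M\<^esub> ?c w'"
      using reversing[OF h] by blast
    \<comment> \<open>The reversal attached to another common multiple ends in the words already
      fixed.\<close>
    moreover from this have "v' = v'' \<and> u' = u''"
      by (intro right_reverses_unique[OF rev])
    ultimately show ?thesis
      unfolding carrier_presented_monoid by blast
  qed
  ultimately have "complements ?M (?c u) (?c v) (?c v') (?c u')"
    using u' v' unfolding complements_def carrier_presented_monoid by blast
  then show ?thesis by blast
qed

lemma complemented_presented_monoid:
  assumes "right_reversing_complete S R"
  shows "complemented_monoid (presented_monoid S R)"
proof -
  interpret monoid "presented_monoid S R"
    by (rule monoid_presented_monoid[OF relations_subset])
  show ?thesis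
    by unfold_locales
      (use ex_complements_presented_monoid[OF assms] in \<open>auto simp: carrier_presented_monoid\<close>)
qed

end

section \<open>Computing right-lcms\<close>

text \<open>Write C(x, y) for the complement of \<open>x\<close>, \<open>y\<close>. Reading
  \<open>s\<close> in state \<open>q\<close> emits a word for C(q, s) and leads to the state C(s,
  q).\<close>

locale complement_transducer =
  fixes S :: "'a set" and R :: "'a relations" and Q :: "'a list set set"
    and \<delta> :: "'a list set \<Rightarrow> 'a \<Rightarrow> ('a list set \<times> 'a list) option"
  assumes R: "R \<subseteq> lists S \<times> lists S"
    and Q: "Q \<subseteq> carrier (presented_monoid S R)"
    and letters: "s \<in> S \<Longrightarrow> word_class S R [s] \<in> Q"
    and \<delta>_Some: "\<lbrakk>q \<in> Q; s \<in> S; \<delta> q s = Some (q', w)\<rbrakk> \<Longrightarrow> q' \<in> Q \<and> w \<in> lists S \<and>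
      complements (presented_monoid S R) q (word_class S R [s]) (word_class S R w) q'"
    and \<delta>_None: "\<lbrakk>q \<in> Q; s \<in> S; \<delta> q s = None\<rbrakk> \<Longrightarrow>
      \<not> common_multiple (presented_monoid S R) q (word_class S R [s])"
begin

abbreviation pmon :: "'a list set monoid" where "pmon \<equiv> presented_monoid S R"
abbreviation cl :: "'a list \<Rightarrow> 'a list set" where "cl \<equiv> word_class S R"

lemma monoid_pmon: "monoid pmon"
  by (rule monoid_presented_monoid[OF R])

lemma cl_append: "u \<in> lists S \<Longrightarrow> v \<in> lists S \<Longrightarrow> cl (u @ v) = cl u \<otimes>\<^bsub>pmon\<^esub> cl v"
  using word_class_mult[OF R] by simp

lemma cl_Cons: "s \<in> S \<Longrightarrow> v \<in> lists S \<Longrightarrow> cl (s # v) = cl [s] \<otimes>\<^bsub>pmon\<^esub> cl v"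
  using cl_append[of "[s]" v] by simp

lemma cl_Nil: "cl [] = \<one>\<^bsub>pmon\<^esub>"
  by (simp add: presented_monoid_def)

lemma cl_closed: "u \<in> lists S \<Longrightarrow> cl u \<in> carrier pmon"
  by (auto simp: presented_monoid_def quotient_def word_class_def)

text \<open>Pasting gives the recursion C(q, s v) = C(q, s) C(C(s, q), v), where C(x, y) is the
  complement of \<open>x\<close>, \<open>y\<close>. The state and the word emitted so far are
  general for the induction.\<close>

lemma foldl_transducer_step:
  assumes "v \<in> lists S" and "q \<in> Q"
  shows "case foldl (transducer_step \<delta>) (Some (q, acc)) v of
      None \<Rightarrow> \<not> common_multiple pmon q (cl v)
    | Some (q', w) \<Rightarrow> \<exists>w'\<in>lists S. w = acc @ w' \<and> complements pmon q (cl v) (cl w') q'"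
  using assms
proof (induction v arbitrary: q acc rule: list.induct)
  case Nil
  then show ?case
    using monoid.complements_one[OF monoid_pmon, of q] Q cl_Nil
    by (auto intro!: bexI[of _ "[]"])
next
  case (Cons s v)
  then have s: "s \<in> S" and v: "v \<in> lists S" and q: "q \<in> Q"
    by auto
  then have carr: "q \<in> carrier pmon" "cl [s] \<in> carrier pmon" "cl v \<in> carrier pmon"
    using Q cl_closed by auto
  note cl = cl_Cons[OF s v]
  show ?case
  proof (cases "\<delta> q s")
    case None
    then have "\<not> common_multiple pmon q (cl (s # v))"
      using \<delta>_None[OF q s] monoid.common_multiple_mult_left[OF monoid_pmon _ carr(2,3), of q] cl by auto
    then show ?thesis
      using None by simp
  next
    case (Some r)
    then obtain p w where pw: "\<delta> q s = Some (p, w)"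
      by (cases r) auto
    then have p: "p \<in> Q" and w: "w \<in> lists S" and c: "complements pmon q (cl [s]) (cl w) p"
      using \<delta>_Some[OF q s] by auto
    have step: "foldl (transducer_step \<delta>) (Some (q, acc)) (s # v)
        = foldl (transducer_step \<delta>) (Some (p, acc @ w)) v"
      by (simp add: pw)
    note IH = Cons.IH[OF v p, of "acc @ w"]
    show ?thesis
    proof (cases "foldl (transducer_step \<delta>) (Some (p, acc @ w)) v")
      case None
      then have "\<not> common_multiple pmon p (cl v)"
        using IH by simp
      then have "\<not> common_multiple pmon q (cl (s # v))"
        using monoid.common_multiple_paste[OF monoid_pmon c _ carr] cl by auto
      then show ?thesis
        unfolding step None by simp
    next
      case (Some r')
      then obtain q' x where qx: "foldl (transducer_step \<delta>) (Some (p, acc @ w)) v = Some (q', x)"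
        by (cases r') auto
      then obtain w' where w': "w' \<in> lists S" "x = (acc @ w) @ w'" "complements pmon p (cl v) (cl w') q'"
        using IH by auto
      have "complements pmon q (cl (s # v)) (cl (w @ w')) q'"
        using monoid.complements_paste[OF monoid_pmon c w'(3) carr] cl cl_append[OF w w'(1)] by simp
      then show ?thesis
        unfolding step qx using w w' by (auto intro!: bexI[of _ "w @ w'"])
    qed
  qed
qed

text \<open>The recursion is C(s u, v) = C(u, C(s, v)), with C(x, y) the complement of
  \<open>x\<close>, \<open>y\<close>; a run from the class of \<open>s\<close> supplies C(s, v).
  Here the product is the first argument, so pasting is applied to the transposed squares.\<close>

lemma foldl_cascade_step:
  assumes "u \<in> lists S" and "v \<in> lists S"
  shows "case foldl (cascade_step \<delta> (\<lambda>s. cl [s])) (Some v) u of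
      None \<Rightarrow> \<not> common_multiple pmon (cl u) (cl v)
    | Some w \<Rightarrow> w \<in> lists S \<and> (\<exists>b. complements pmon (cl u) (cl v) (cl w) b)"
  using assms
proof (induction u arbitrary: v rule: list.induct)
  case Nil
  then show ?case
    using complements_sym[OF monoid.complements_one[OF monoid_pmon, of "cl v"]] cl_closed cl_Nil by auto
next
  case (Cons s u)
  then have s: "s \<in> S" and u: "u \<in> lists S" and v: "v \<in> lists S"
    by auto
  then have carr: "cl v \<in> carrier pmon" "cl [s] \<in> carrier pmon" "cl u \<in> carrier pmon"
    using cl_closed by auto
  note cl = cl_Cons[OF s u] and run = foldl_transducer_step[OF v letters[OF s], of "[]"]
  show ?case
  proof (cases "transduce \<delta> (cl [s]) v")
    case None
    then have "\<not> common_multiple pmon (cl [s]) (cl v)"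
      using run by (simp add: transduce_def)
    then have "\<not> common_multiple pmon (cl (s # u)) (cl v)"
      using monoid.common_multiple_mult_left[OF monoid_pmon _ carr(2,3), of "cl v"] cl
        common_multiple_sym[of pmon] by metis
    then show ?thesis
      using None by simp
  next
    case (Some r)
    then obtain b x where bx: "transduce \<delta> (cl [s]) v = Some (b, x)"
      by (cases r) auto
    then have x: "x \<in> lists S" and c': "complements pmon (cl [s]) (cl v) (cl x) b"
      using run by (auto simp: transduce_def)
    note c = complements_sym[OF c']
    have step: "foldl (cascade_step \<delta> (\<lambda>s. cl [s])) (Some v) (s # u)
        = foldl (cascade_step \<delta> (\<lambda>s. cl [s])) (Some x) u"
      by (simp add: bx)
    note IH = Cons.IH[OF u x]
    show ?thesis
    proof (cases "foldl (cascade_step \<delta> (\<lambda>s. cl [s])) (Some x) u")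
      case None
      then have "\<not> common_multiple pmon (cl u) (cl x)"
        using IH by simp
      then have "\<not> common_multiple pmon (cl (s # u)) (cl v)"
        using monoid.common_multiple_paste[OF monoid_pmon c _ carr] cl common_multiple_sym[of pmon] by metis
      then show ?thesis
        unfolding step None by simp
    next
      case (Some w)
      then obtain b' where w: "w \<in> lists S" and c'': "complements pmon (cl u) (cl x) (cl w) b'"
        using IH by auto
      have "complements pmon (cl v) (cl (s # u)) (b \<otimes>\<^bsub>pmon\<^esub> b') (cl w)"
        using monoid.complements_paste[OF monoid_pmon c complements_sym[OF c''] carr] cl by simp
      from complements_sym[OF this] show ?thesis
        unfolding step Some using w by auto
    qed
  qed
qed

end

theorem proposition4p20:
  fixes S :: "'a set" and R :: "('a list \<times> 'a list) set"
  defines "M \<equiv> presented_monoid S R"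
  assumes "finite S"
    and "right_complemented S R"
    and "right_reversing_complete S R"
    and "noetherian_monoid M"
    and "\<exists>G. finite G \<and> garside_family M G"
  shows "\<exists>f :: 'a list \<Rightarrow> 'a list \<Rightarrow> 'a list option.
    computable_on_words S f \<and>
    (\<forall>u\<in>lists S. \<forall>v\<in>lists S.
       (case f u v of
          Some w \<Rightarrow> w \<in> lists S \<and>
            (word_class S R w) lcmof\<^bsub>M\<^esub> (word_class S R u) (word_class S R v)
        | None \<Rightarrow>
            \<not> (\<exists>m\<in>carrier M. (word_class S R u) divides\<^bsub>M\<^esub> m \<and> (word_class S R v) divides\<^bsub>M\<^esub> m)))"
proof -
  let ?cl = "word_class S R"
  note R = relations_subset[OF assms(3)]
  note carrier = carrier_presented_monoid[OF assms(3), folded M_def]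
  interpret complemented_monoid M
    unfolding M_def by (rule complemented_presented_monoid[OF assms(3,4)])
  obtain \<G> where \<G>: "finite \<G>" "garside_family M \<G>"
    using assms(6) by blast
  obtain Q where Q: "finite Q" "(\<lambda>s. ?cl [s]) ` S \<subseteq> Q" "Q \<subseteq> carrier M"
    "\<And>q x. q \<in> Q \<Longrightarrow> x \<in> (\<lambda>s. ?cl [s]) ` S \<Longrightarrow> common_multiple M q x \<Longrightarrow>
       \<exists>a. \<exists>q'\<in>Q. complements M q x a q'"
    by (rule garside_finite_complement_closed[OF \<G>(2,1), of "(\<lambda>s. ?cl [s]) ` S"])
      (use assms(2) carrier in auto)
  \<comment> \<open>A successor exists by closure of \<open>Q\<close>, an output word because every
    element is the class of a word. One such pair is chosen for each table entry.\<close>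
  define good where "good q s r \<longleftrightarrow> fst r \<in> Q \<and> snd r \<in> lists S \<and>
    complements M q (?cl [s]) (?cl (snd r)) (fst r)" for q s r
  define \<delta> where "\<delta> q s = (if common_multiple M q (?cl [s]) then Some (SOME r. good q s r) else None)"
    for q s
  have good: "good q s (SOME r. good q s r)"
    if q: "q \<in> Q" and s: "s \<in> S" and m: "common_multiple M q (?cl [s])" for q s
  proof -
    obtain a q' where "q' \<in> Q" "complements M q (?cl [s]) a q'"
      using Q(4)[OF q imageI[OF s] m] by blast
    moreover from this obtain w where "w \<in> lists S" "a = ?cl w"
      using complements_closed[of M] carrier by blast
    ultimately have "good q s (q', w)"
      by (simp add: good_def)
    then show ?thesis
      by (rule someI)
  qed
  interpret transducer: complement_transducer S R Q \<delta>
  proof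
    show "q' \<in> Q \<and> w \<in> lists S \<and> complements (presented_monoid S R) q (?cl [s]) (?cl w) q'"
      if "q \<in> Q" "s \<in> S" "\<delta> q s = Some (q', w)" for q s q' w
      using good[OF that(1,2)] that(3) by (auto simp: \<delta>_def good_def M_def split: if_splits)
  qed (use R Q in \<open>auto simp: \<delta>_def M_def split: if_splits\<close>)
  let ?f = "\<lambda>u v. map_option ((@) u) (cascade \<delta> (\<lambda>s. ?cl [s]) u v)"
  have "computable_on_words S ?f"
    by (rule computable_cascade[OF Q(1) assms(2)]) (use transducer.letters transducer.\<delta>_Some in blast)+
  moreover have "case ?f u v of
      Some w \<Rightarrow> w \<in> lists S \<and> (?cl w) lcmof\<^bsub>M\<^esub> (?cl u) (?cl v)
    | None \<Rightarrow> \<not> (\<exists>m\<in>carrier M. (?cl u) divides\<^bsub>M\<^esub> m \<and> (?cl v) divides\<^bsub>M\<^esub> m)"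
    if u: "u \<in> lists S" and v: "v \<in> lists S" for u v
  proof (cases "cascade \<delta> (\<lambda>s. ?cl [s]) u v")
    case None
    then show ?thesis
      using transducer.foldl_cascade_step[OF u v]
      by (auto simp: cascade_def common_multiple_iff_divides M_def)
  next
    case (Some w)
    then obtain b where w: "w \<in> lists S" and "complements M (?cl u) (?cl v) (?cl w) b"
      using transducer.foldl_cascade_step[OF u v] by (auto simp: cascade_def M_def)
    then have "(?cl u \<otimes>\<^bsub>M\<^esub> ?cl w) lcmof\<^bsub>M\<^esub> (?cl u) (?cl v)"
      using complements_imp_lcmof transducer.cl_closed[folded M_def] u v by blast
    then show ?thesis
      using Some u w transducer.cl_append[OF u w] by (simp add: M_def)
  qed
  ultimately show ?thesis
    by blast
qed

end
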